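(* Let $u: A\to B$ be a central pair of nonpositive DG rings (with $A$ a commutative DG ring). Suppose we are given two factorizations $u=v\circ\tilde{u}$ and $u=v'\circ\tilde{u}'$, with $$A\xrightarrow{\tilde{u}}\tilde{B}\xrightarrow{v}B,\qquad A\xrightarrow{\tilde{u}'}\tilde{B}'\xrightarrow{v'}B,$$ in the category of nonpositive central DG $A$-rings, such that $v$ is a surjective quasi-isomorphism, and either of these two conditions holds: (i) the DG ring $\tilde{B}$ is commutative, and the DG ring $\tilde{B}'$ is commutative semi-free over $A$; (ii) the DG ring $\tilde{B}'$ is noncommutative semi-free over $A$. Then there exists a DG ring homomorphism $w:\tilde{B}'\to\tilde{B}$ such that $w\circ\tilde{u}'=\tilde{u}$ and $v\circ w=v'$.
   Context: DG rings are associative unital cohomologically $\mathbb{Z}$-graded rings with a differential of degree $1$ satisfying the graded Leibniz rule; homomorphisms preserve degree, unit and differential. $A$ is nonpositive if $A^i=0$ for $i>0$. A commutative DG ring is a nonpositive DG ring with $ab=(-1)^{ij}ba$ for $a\in A^i$, $b\in A^j$ and $a^2=0$ for $a$ of odd degree. The center of a DG ring $B$ consists of sums of homogeneous $b$ with $bc=(-1)^{ij}cb$ for all $c\in B^j$ ($b\in B^i$). A central pair is a DG ring homomorphism $u:A\to B$ with $A$ commutative and $u(A)$ contained in the center of $B$. For a commutative DG ring $A$, a nonpositive central DG $A$-ring is a nonpositive DG ring $B$ with a homomorphism $A\to B$ whose image lies in the center of $B$; morphisms are DG ring homomorphisms compatible with the homomorphisms from $A$. $A^\natural$ denotes the graded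 ring underlying $A$. For a graded set $X=\coprod_i X^i$, $\mathbb{Z}\langle X\rangle$ is the noncommutative polynomial ring (graded), and $\mathbb{Z}[X]$ is its quotient by the two-sided ideal generated by $yx-(-1)^{ij}xy$ ($x\in X^i$, $y\in X^j$) and $z^2$ ($z\in X^k$, $k$ odd). $X$ is nonpositive if $X^i=\varnothing$ for $i>0$. A nonpositive central DG $A$-ring $B$ is commutative semi-free (resp. noncommutative semi-free) over $A$ if there is an isomorphism of graded $A^\natural$-rings $B^\natural\cong A^\natural\otimes_{\mathbb{Z}}\mathbb{Z}[X]$ (resp. $B^\natural\cong A^\natural\otimes_{\mathbb{Z}}\mathbb{Z}\langle X\rangle$) for some nonpositive graded set $X$. *)

theory Defs
  imports "HOL-Algebra.QuotRing" "HOL-Library.Poly_Mapping"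
begin

section \<open>Graded rings\<close>

record 'a graded_ring = "'a ring" +
  homog :: "int \<Rightarrow> 'a set"

definition koszul_sign :: "int \<Rightarrow> int" where
  "koszul_sign n = (if even n then 1 else - 1)"

text \<open>A ring that is the internal direct sum of the additive subgroups \<^term>\<open>homog R i\<close>.
  The zero ring is allowed.\<close>

locale graded_ring = ring R for R :: "('a, 'm) graded_ring_scheme" (structure) +
  assumes homog_subgroup: "additive_subgroup (homog R i) R"
    and homog_one: "\<one> \<in> homog R 0"
    and homog_mult: "\<lbrakk>a \<in> homog R i; b \<in> homog R j\<rbrakk> \<Longrightarrow> a \<otimes> b \<in> homog R (i + j)"
    and homog_decomposition:
      "x \<in> carrier R \<Longrightarrow>
        \<exists>!c. (\<forall>i. c i \<in> homog R i) \<and> finite {i. c i \<noteq> \<zero>} \<and> x = (\<Oplus>i\<in>{i. c i \<noteq> \<zero>}. c i)"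

definition graded_center :: "('a, 'm) graded_ring_scheme \<Rightarrow> 'a set" where
  "graded_center R =
    {\<Oplus>\<^bsub>R\<^esub>i\<in>I. b i | I b. finite I \<and>
      (\<forall>i\<in>I. b i \<in> homog R i \<and>
        (\<forall>j. \<forall>c\<in>homog R j. b i \<otimes>\<^bsub>R\<^esub> c = [koszul_sign (i * j)] \<cdot>\<^bsub>R\<^esub> (c \<otimes>\<^bsub>R\<^esub> b i)))}"

text \<open>The quotient by an ideal, graded by the images of the homogeneous parts
  (a grading when the ideal is generated by homogeneous elements).\<close>

definition graded_quotient :: "('a, 'm) graded_ring_scheme \<Rightarrow> 'a set \<Rightarrow> 'a set graded_ring" where
  "graded_quotient R I =
    ring.extend (R Quot I) (graded_ring.fields (\<lambda>i. (\<lambda>x. I +>\<^bsub>R\<^esub> x) ` homog R i))"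


section \<open>DG rings\<close>

record 'a dg_ring = "'a graded_ring" +
  differential :: "'a \<Rightarrow> 'a"

locale dg_ring = graded_ring A for A :: "('a, 'm) dg_ring_scheme" (structure) +
  assumes differential_add:
      "\<lbrakk>a \<in> carrier A; b \<in> carrier A\<rbrakk> \<Longrightarrow>
        differential A (a \<oplus> b) = differential A a \<oplus> differential A b"
    and differential_degree: "a \<in> homog A i \<Longrightarrow> differential A a \<in> homog A (i + 1)"
    and differential_square: "a \<in> carrier A \<Longrightarrow> differential A (differential A a) = \<zero>"
    and leibniz:
      "\<lbrakk>a \<in> homog A i; b \<in> homog A j\<rbrakk> \<Longrightarrow>
        differential A (a \<otimes> b) =
          differential A a \<otimes> b \<oplus> [koszul_sign i] \<cdot> (a \<otimes> differential A b)"

locale nonpositive_dg_ring = dg_ring +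
  assumes nonpositive: "i > 0 \<Longrightarrow> homog A i = {\<zero>}"

locale commutative_dg_ring = nonpositive_dg_ring +
  assumes graded_commutative:
      "\<lbrakk>a \<in> homog A i; b \<in> homog A j\<rbrakk> \<Longrightarrow> a \<otimes> b = [koszul_sign (i * j)] \<cdot> (b \<otimes> a)"
    and odd_square_zero: "\<lbrakk>a \<in> homog A i; odd i\<rbrakk> \<Longrightarrow> a \<otimes> a = \<zero>"

definition dg_ring_hom ::
    "('a, 'm) dg_ring_scheme \<Rightarrow> ('b, 'n) dg_ring_scheme \<Rightarrow> ('a \<Rightarrow> 'b) set" where
  "dg_ring_hom A B =
    {f \<in> ring_hom A B.
      (\<forall>i. f ` homog A i \<subseteq> homog B i) \<and>
      (\<forall>a\<in>carrier A. f (differential A a) = differential B (f a))}"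

definition cocycles :: "('a, 'm) dg_ring_scheme \<Rightarrow> int \<Rightarrow> 'a set" where
  "cocycles A i = {a \<in> homog A i. differential A a = \<zero>\<^bsub>A\<^esub>}"

definition coboundaries :: "('a, 'm) dg_ring_scheme \<Rightarrow> int \<Rightarrow> 'a set" where
  "coboundaries A i = differential A ` homog A (i - 1)"

definition cohomology :: "('a, 'm) dg_ring_scheme \<Rightarrow> int \<Rightarrow> 'a set monoid" where
  "cohomology A i = (add_monoid A)\<lparr>carrier := cocycles A i\<rparr> Mod coboundaries A i"

text \<open>For a DG ring homomorphism \<open>f\<close> the union below consists of identical cosets:
  it is the class of \<open>f z\<close>, for any representative \<open>z\<close> of the class \<open>C\<close>.\<close>

definition cohomology_map ::
    "('b, 'n) dg_ring_scheme \<Rightarrow> ('a \<Rightarrow> 'b) \<Rightarrow> int \<Rightarrow> 'a set \<Rightarrow> 'b set" where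
  "cohomology_map B f i C = (\<Union>z\<in>C. coboundaries B i +>\<^bsub>B\<^esub> f z)"

definition quasi_isomorphism ::
    "('a, 'm) dg_ring_scheme \<Rightarrow> ('b, 'n) dg_ring_scheme \<Rightarrow> ('a \<Rightarrow> 'b) \<Rightarrow> bool" where
  "quasi_isomorphism A B f \<longleftrightarrow>
    f \<in> dg_ring_hom A B \<and>
    (\<forall>i. cohomology_map B f i \<in> iso (cohomology A i) (cohomology B i))"


section \<open>Central pairs\<close>

definition central_pair ::
    "('a, 'm) dg_ring_scheme \<Rightarrow> ('b, 'n) dg_ring_scheme \<Rightarrow> ('a \<Rightarrow> 'b) \<Rightarrow> bool" where
  "central_pair A B u \<longleftrightarrow>
    commutative_dg_ring A \<and> dg_ring B \<and> u \<in> dg_ring_hom A B \<and>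
    u ` carrier A \<subseteq> graded_center B"

definition nonpositive_central_dg_ring ::
    "('a, 'm) dg_ring_scheme \<Rightarrow> ('b, 'n) dg_ring_scheme \<Rightarrow> ('a \<Rightarrow> 'b) \<Rightarrow> bool" where
  "nonpositive_central_dg_ring A B u \<longleftrightarrow> central_pair A B u \<and> nonpositive_dg_ring B"

text \<open>Morphisms from the central DG \<open>A\<close>-ring \<open>(B, u)\<close> to \<open>(C, t)\<close>.\<close>

definition central_dg_ring_hom ::
    "('a, 'l) dg_ring_scheme \<Rightarrow> ('b, 'm) dg_ring_scheme \<Rightarrow> ('a \<Rightarrow> 'b) \<Rightarrow>
      ('c, 'n) dg_ring_scheme \<Rightarrow> ('a \<Rightarrow> 'c) \<Rightarrow> ('b \<Rightarrow> 'c) set" where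
  "central_dg_ring_hom A B u C t = {f \<in> dg_ring_hom B C. \<forall>a\<in>carrier A. f (u a) = t a}"


section \<open>Polynomial rings and tensor products\<close>

text \<open>The free abelian group on \<open>S\<close>, with the product given on basis elements by
  \<open>s \<cdot> t = \<sigma> s t (m s t)\<close>, where \<open>\<sigma> s t\<close> is a sign, and with \<open>s\<close> in degree \<open>\<delta> s\<close>.\<close>

definition twisted_monoid_ring ::
    "'s set \<Rightarrow> ('s \<Rightarrow> 's \<Rightarrow> 's) \<Rightarrow> 's \<Rightarrow> ('s \<Rightarrow> 's \<Rightarrow> int) \<Rightarrow> ('s \<Rightarrow> int) \<Rightarrow>
      ('s \<Rightarrow>\<^sub>0 int) graded_ring" where
  "twisted_monoid_ring S m e \<sigma> \<delta> =
    \<lparr>carrier = {f. Poly_Mapping.keys f \<subseteq> S},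
     mult = (\<lambda>f g. frag_extend (\<lambda>s. frag_extend (\<lambda>t. frag_cmul (\<sigma> s t) (frag_of (m s t))) g) f),
     one = frag_of e,
     zero = 0,
     add = (+),
     homog = (\<lambda>i. {f. Poly_Mapping.keys f \<subseteq> {s \<in> S. \<delta> s = i}})\<rparr>"

text \<open>A graded set is a family \<open>X\<close> of sets indexed by the degree. Its coproduct is the disjoint
  union \<^term>\<open>Sigma UNIV X\<close>, so a generator is a pair \<open>(i, x)\<close> with \<open>x \<in> X i\<close>, of degree \<open>i\<close>.
  The noncommutative monomials are the words in the generators.\<close>

definition nonpositive_graded_set :: "(int \<Rightarrow> 'x set) \<Rightarrow> bool" where
  "nonpositive_graded_set X \<longleftrightarrow> (\<forall>i>0. X i = {})"

definition noncomm_polynomial_ring ::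
    "(int \<Rightarrow> 'x set) \<Rightarrow> ((int \<times> 'x) list \<Rightarrow>\<^sub>0 int) graded_ring" where
  "noncomm_polynomial_ring X =
    twisted_monoid_ring (lists (Sigma UNIV X)) (@) [] (\<lambda>_ _. 1) (\<lambda>w. sum_list (map fst w))"

definition comm_polynomial_relations ::
    "(int \<Rightarrow> 'x set) \<Rightarrow> ((int \<times> 'x) list \<Rightarrow>\<^sub>0 int) set" where
  "comm_polynomial_relations X =
    {frag_of [(j, y), (i, x)] - frag_cmul (koszul_sign (i * j)) (frag_of [(i, x), (j, y)]) |
      i j x y. x \<in> X i \<and> y \<in> X j} \<union>
    {frag_of [(k, z), (k, z)] | k z. z \<in> X k \<and> odd k}"

definition comm_polynomial_ring ::
    "(int \<Rightarrow> 'x set) \<Rightarrow> ((int \<times> 'x) list \<Rightarrow>\<^sub>0 int) set graded_ring" where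
  "comm_polynomial_ring X =
    graded_quotient (noncomm_polynomial_ring X)
      (Idl\<^bsub>noncomm_polynomial_ring X\<^esub> (comm_polynomial_relations X))"

text \<open>The tensor product over the integers of graded rings \<open>R\<close> and \<open>S\<close>, as the direct sum of the
  \<open>R\<^sup>i \<otimes> S\<^sup>j\<close>: the free abelian group on symbols \<open>(i, r, j, s)\<close> with \<open>r \<in> R\<^sup>i\<close> and \<open>s \<in> S\<^sup>j\<close>,
  modulo biadditivity. Already on symbols, the Koszul product
  \<open>(r \<otimes> s) (r' \<otimes> s') = (-1)\<^sup>j\<^sup>i\<^sup>' r r' \<otimes> s s'\<close>, where \<open>s\<close> has degree \<open>j\<close> and \<open>r'\<close> has degree \<open>i'\<close>,
  is associative, and the subgroup spanned by the biadditivity relations is a two-sided ideal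
  for it. Hence generating an ideal by them imposes nothing further.\<close>

definition tensor_symbol_ring ::
    "('a, 'm) graded_ring_scheme \<Rightarrow> ('b, 'n) graded_ring_scheme \<Rightarrow>
      ((int \<times> 'a \<times> int \<times> 'b) \<Rightarrow>\<^sub>0 int) graded_ring" where
  "tensor_symbol_ring R S =
    twisted_monoid_ring {(i, r, j, s). r \<in> homog R i \<and> s \<in> homog S j}
      (\<lambda>(i, r, j, s) (i', r', j', s'). (i + i', r \<otimes>\<^bsub>R\<^esub> r', j + j', s \<otimes>\<^bsub>S\<^esub> s'))
      (0, \<one>\<^bsub>R\<^esub>, 0, \<one>\<^bsub>S\<^esub>)
      (\<lambda>(i, r, j, s) (i', r', j', s'). koszul_sign (j * i'))
      (\<lambda>(i, r, j, s). i + j)"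

definition biadditivity_relations ::
    "('a, 'm) graded_ring_scheme \<Rightarrow> ('b, 'n) graded_ring_scheme \<Rightarrow>
      ((int \<times> 'a \<times> int \<times> 'b) \<Rightarrow>\<^sub>0 int) set" where
  "biadditivity_relations R S =
    {frag_of (i, r \<oplus>\<^bsub>R\<^esub> r', j, s) - frag_of (i, r, j, s) - frag_of (i, r', j, s) |
      i r r' j s. r \<in> homog R i \<and> r' \<in> homog R i \<and> s \<in> homog S j} \<union>
    {frag_of (i, r, j, s \<oplus>\<^bsub>S\<^esub> s') - frag_of (i, r, j, s) - frag_of (i, r, j, s') |
      i r j s s'. r \<in> homog R i \<and> s \<in> homog S j \<and> s' \<in> homog S j}"

definition biadditivity_ideal ::
    "('a, 'm) graded_ring_scheme \<Rightarrow> ('b, 'n) graded_ring_scheme \<Rightarrow>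
      ((int \<times> 'a \<times> int \<times> 'b) \<Rightarrow>\<^sub>0 int) set" where
  "biadditivity_ideal R S = Idl\<^bsub>tensor_symbol_ring R S\<^esub> (biadditivity_relations R S)"

definition graded_tensor ::
    "('a, 'm) graded_ring_scheme \<Rightarrow> ('b, 'n) graded_ring_scheme \<Rightarrow>
      ((int \<times> 'a \<times> int \<times> 'b) \<Rightarrow>\<^sub>0 int) set graded_ring" where
  "graded_tensor R S = graded_quotient (tensor_symbol_ring R S) (biadditivity_ideal R S)"

text \<open>The class of \<open>r \<otimes> s\<close> for homogeneous \<open>r\<close> and \<open>s\<close> of degrees \<open>i\<close> and \<open>j\<close>.\<close>

definition pure_tensor ::
    "('a, 'm) graded_ring_scheme \<Rightarrow> ('b, 'n) graded_ring_scheme \<Rightarrow>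
      int \<Rightarrow> 'a \<Rightarrow> int \<Rightarrow> 'b \<Rightarrow> ((int \<times> 'a \<times> int \<times> 'b) \<Rightarrow>\<^sub>0 int) set" where
  "pure_tensor R S i r j s =
    biadditivity_ideal R S +>\<^bsub>tensor_symbol_ring R S\<^esub> frag_of (i, r, j, s)"


section \<open>Semi-free DG rings\<close>

text \<open>Isomorphisms of graded \<open>A\<close>-rings from \<open>(B, u)\<close> to the tensor product of \<open>A\<close> with \<open>P\<close>,
  the latter being an \<open>A\<close>-ring by \<open>a \<mapsto> a \<otimes> 1\<close>. Any differentials of \<open>A\<close> and \<open>B\<close> are
  ignored. By additivity, compatibility with the maps from \<open>A\<close> need only be required on
  homogeneous elements.\<close>

definition graded_tensor_iso ::
    "('a, 'l) graded_ring_scheme \<Rightarrow> ('b, 'm) graded_ring_scheme \<Rightarrow> ('a \<Rightarrow> 'b) \<Rightarrow>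
      ('p, 'n) graded_ring_scheme \<Rightarrow> ('b \<Rightarrow> ((int \<times> 'a \<times> int \<times> 'p) \<Rightarrow>\<^sub>0 int) set) set" where
  "graded_tensor_iso A B u P =
    {\<phi> \<in> ring_iso B (graded_tensor A P).
      (\<forall>i. \<phi> ` homog B i = homog (graded_tensor A P) i) \<and>
      (\<forall>i. \<forall>a\<in>homog A i. \<phi> (u a) = pure_tensor A P i a 0 \<one>\<^bsub>P\<^esub>)}"

text \<open>The type argument is the type from which the elements of the graded set are drawn.\<close>

definition commutative_semi_free ::
    "'x itself \<Rightarrow> ('a, 'm) dg_ring_scheme \<Rightarrow> ('b, 'n) dg_ring_scheme \<Rightarrow> ('a \<Rightarrow> 'b) \<Rightarrow> bool" where
  "commutative_semi_free _ A B u \<longleftrightarrow>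
    nonpositive_central_dg_ring A B u \<and>
    (\<exists>X :: int \<Rightarrow> 'x set. nonpositive_graded_set X \<and>
      graded_tensor_iso A B u (comm_polynomial_ring X) \<noteq> {})"

definition noncommutative_semi_free ::
    "'x itself \<Rightarrow> ('a, 'm) dg_ring_scheme \<Rightarrow> ('b, 'n) dg_ring_scheme \<Rightarrow> ('a \<Rightarrow> 'b) \<Rightarrow> bool" where
  "noncommutative_semi_free _ A B u \<longleftrightarrow>
    nonpositive_central_dg_ring A B u \<and>
    (\<exists>X :: int \<Rightarrow> 'x set. nonpositive_graded_set X \<and>
      graded_tensor_iso A B u (noncomm_polynomial_ring X) \<noteq> {})"

end

theory Submission
  imports Defs "HOL-Algebra.Free_Abelian_Groups"
begin

text \<open>
  As a graded ring, \<open>B2\<close> is a polynomial ring over \<open>A\<close>. A map of graded \<open>A\<close>-rings from \<open>B2\<close> to \<open>B1\<close>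
  therefore amounts to a choice of a homogeneous element of \<open>B1\<close> of the right degree for every
  variable: the values on \<open>A\<close> are given by \<open>u1\<close>, the image of \<open>u1\<close> is central, so that it can be
  moved past the values of the variables with the signs of the tensor product, and in the
  commutative case the values satisfy the relations between the variables because \<open>B1\<close> is
  commutative (\<open>graded_hom_extension\<close>). Whether such a map respects the differentials and the maps to
  \<open>B\<close> can be tested on the variables.

  The variables are treated in the order of decreasing degree. Since \<open>A\<close> and all variables have
  nonpositive degree, an element of degree \<open>k\<close> is a combination of monomials whose variables have
  degree at least \<open>k\<close> (\<open>monomials_span\<close>, \<open>monomial_induct\<close>). In particular the differential of a
  variable \<open>x\<close> of degree \<open>-n\<close> only involves variables of larger degree. If \<open>W\<close> is correct on these,
  then \<open>W (d x)\<close> is a cocycle of \<open>B1\<close> whose image \<open>d (v2 x)\<close> in \<open>B\<close> is a coboundary. As \<open>v1\<close> is a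
  surjective quasi-isomorphism, some \<open>b\<close> of degree \<open>-n\<close> satisfies \<open>d b = W (d x)\<close> and
  \<open>v1 b = v2 x\<close> (\<open>surjective_quasi_isomorphism_lift\<close>), and \<open>b\<close> is an admissible value for \<open>x\<close>.

  Instead of maps on the subrings generated by the variables of degree greater than \<open>-n\<close>, the
  construction uses maps on all of \<open>B2\<close> that are correct on these variables only (\<open>good\<close>). Each
  stage agrees with the preceding one where the latter is correct (\<open>good_step\<close>), and the limit is
  formed variable by variable (\<open>lift_exists\<close>).
\<close>

section \<open>Additive spans and factorization of ring homomorphisms\<close>

lemma (in ring) additive_span_induct [consumes 2, case_names zero generator diff]:
  assumes "x \<in> generate (add_monoid R) S" and "S \<subseteq> carrier R"
    and "P \<zero>" and "\<And>s. s \<in> S \<Longrightarrow> P s"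
    and diff: "\<And>a b. \<lbrakk>a \<in> carrier R; b \<in> carrier R; P a; P b\<rbrakk> \<Longrightarrow> P (a \<ominus> b)"
  shows "P x"
proof -
  have "x \<in> carrier R \<and> P x"
    using assms(1)
  proof (induction rule: generate.induct)
    case one
    then show ?case using assms(3) by simp
  next
    case (incl h)
    then show ?case using assms by auto
  next
    case (inv h)
    then have h: "h \<in> carrier R" "P h" using assms by auto
    have "inv\<^bsub>add_monoid R\<^esub> h = \<zero> \<ominus> h"
      using h by (simp add: a_inv_def[symmetric] minus_eq)
    then show ?case using diff[of \<zero> h] h assms(3) by simp
  next
    case (eng a b)
    then have ab: "a \<in> carrier R" "b \<in> carrier R" "P a" "P b" by auto
    then have "P (\<zero> \<ominus> b)" using diff assms(3) by simp
    then have "P (a \<ominus> (\<zero> \<ominus> b))" using diff ab by simp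
    moreover have "a \<ominus> (\<zero> \<ominus> b) = a \<oplus> b" using ab by (simp add: minus_eq)
    ultimately show ?case using ab by simp
  qed
  then show ?thesis ..
qed

lemma (in ring) additive_span_subgroup:
  assumes "S \<subseteq> carrier R"
  shows "additive_subgroup (generate (add_monoid R) S) R"
  using add.generate_is_subgroup[of S] assms by (simp add: additive_subgroupI)

lemma (in ring) additive_subgroup_diffI:
  assumes "H \<subseteq> carrier R" and "\<zero> \<in> H"
    and diff: "\<And>x y. \<lbrakk>x \<in> H; y \<in> H\<rbrakk> \<Longrightarrow> x \<ominus> y \<in> H"
  shows "additive_subgroup H R"
proof (rule additive_subgroupI, rule add.subgroupI)
  have carrier: "x \<in> carrier R" if "x \<in> H" for x using that assms(1) by auto
  have neg: "\<ominus> y \<in> H" if "y \<in> H" for y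
    using diff[OF assms(2) that] carrier[OF that] by (simp add: minus_eq)
  fix x y assume "x \<in> H" "y \<in> H"
  then show "\<ominus> x \<in> H" "x \<oplus> y \<in> H"
    using neg diff[of x "\<ominus> y"] carrier by (simp_all add: minus_eq)
qed (use assms in auto)

lemma (in additive_subgroup) diff_closed:
  assumes "x \<in> H" "y \<in> H"
  shows "x \<ominus> y \<in> H"
  using a_closed[OF assms(1) a_inv_closed[OF assms(2)]] by (simp add: a_minus_def)

lemma (in ring_hom_ring) hom_diff:
  "\<lbrakk>x \<in> carrier R; y \<in> carrier R\<rbrakk> \<Longrightarrow> h (x \<ominus> y) = h x \<ominus>\<^bsub>S\<^esub> h y"
  by (simp add: R.minus_eq S.minus_eq)

text \<open>Applied to quotient maps, and to the composite of a quotient map with an isomorphism.\<close>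

lemma ring_hom_factor:
  assumes "ring R" "ring Q" "ring S"
    and \<pi>: "\<pi> \<in> ring_hom R Q" and surj: "\<pi> ` carrier R = carrier Q"
    and F: "F \<in> ring_hom R S"
    and ker: "\<And>x. \<lbrakk>x \<in> carrier R; \<pi> x = \<zero>\<^bsub>Q\<^esub>\<rbrakk> \<Longrightarrow> F x = \<zero>\<^bsub>S\<^esub>"
  obtains W where "W \<in> ring_hom Q S" "\<And>x. x \<in> carrier R \<Longrightarrow> W (\<pi> x) = F x"
proof -
  interpret p: ring_hom_ring R Q \<pi> using assms by (intro ring_hom_ringI2)
  interpret f: ring_hom_ring R S F using assms by (intro ring_hom_ringI2)
  define W where "W b = F (inv_into (carrier R) \<pi> b)" for b
  have W: "W (\<pi> x) = F x" if x: "x \<in> carrier R" for x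
  proof -
    let ?y = "inv_into (carrier R) \<pi> (\<pi> x)"
    have y: "?y \<in> carrier R" "\<pi> ?y = \<pi> x"
      using x by (auto intro: inv_into_into f_inv_into_f)
    then have "\<pi> (?y \<ominus>\<^bsub>R\<^esub> x) = \<zero>\<^bsub>Q\<^esub>"
      using x by (simp add: p.hom_diff p.S.r_neg p.S.minus_eq)
    then have "F ?y \<ominus>\<^bsub>S\<^esub> F x = \<zero>\<^bsub>S\<^esub>"
      using ker[of "?y \<ominus>\<^bsub>R\<^esub> x"] x y by (simp add: f.hom_diff)
    then have "F ?y \<ominus>\<^bsub>S\<^esub> F x \<oplus>\<^bsub>S\<^esub> F x = F x"
      using x by simp
    then show ?thesis
      using x y by (simp add: W_def f.S.minus_eq f.S.a_assoc f.S.l_neg)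
  qed
  have "W \<in> ring_hom Q S"
  proof (rule ring_hom_memI)
    fix b assume "b \<in> carrier Q"
    then obtain x where "x \<in> carrier R" "b = \<pi> x" using surj by (metis imageE)
    then show "W b \<in> carrier S" by (simp add: W)
  next
    fix b c assume "b \<in> carrier Q" "c \<in> carrier Q"
    then obtain x y where xy: "x \<in> carrier R" "y \<in> carrier R" "b = \<pi> x" "c = \<pi> y"
      using surj by (metis imageE)
    then show "W (b \<otimes>\<^bsub>Q\<^esub> c) = W b \<otimes>\<^bsub>S\<^esub> W c" "W (b \<oplus>\<^bsub>Q\<^esub> c) = W b \<oplus>\<^bsub>S\<^esub> W c"
      by (simp_all add: W flip: p.hom_mult p.hom_add)
  next
    show "W \<one>\<^bsub>Q\<^esub> = \<one>\<^bsub>S\<^esub>"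
      using W[of "\<one>\<^bsub>R\<^esub>"] by simp
  qed
  with W that show thesis by blast
qed

section \<open>Twisted monoid rings\<close>

lemma twisted_monoid_ring_simps [simp]:
  "carrier (twisted_monoid_ring S m e \<sigma> \<delta>) = {f. Poly_Mapping.keys f \<subseteq> S}"
  "\<one>\<^bsub>twisted_monoid_ring S m e \<sigma> \<delta>\<^esub> = frag_of e"
  "\<zero>\<^bsub>twisted_monoid_ring S m e \<sigma> \<delta>\<^esub> = 0"
  "f \<oplus>\<^bsub>twisted_monoid_ring S m e \<sigma> \<delta>\<^esub> g = f + g"
  "homog (twisted_monoid_ring S m e \<sigma> \<delta>) i = {f. Poly_Mapping.keys f \<subseteq> {s \<in> S. \<delta> s = i}}"
  by (simp_all add: twisted_monoid_ring_def)

lemmas frag_within_induct = free_Abelian_group_induct [consumes 1, case_names zero diff basis]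

lemma frag_extend_diff_fun:
  "frag_extend (\<lambda>s. a s - b s) f = frag_extend a f - frag_extend b f"
  using subset_UNIV by (induction f rule: frag_induction) (auto simp: frag_extend_diff)

lemma twisted_mult_diff:
  fixes f f' g g' :: "'s \<Rightarrow>\<^sub>0 int"
  shows "(f - f') \<otimes>\<^bsub>twisted_monoid_ring S m e \<sigma> \<delta>\<^esub> g =
      f \<otimes>\<^bsub>twisted_monoid_ring S m e \<sigma> \<delta>\<^esub> g - f' \<otimes>\<^bsub>twisted_monoid_ring S m e \<sigma> \<delta>\<^esub> g"
    and "f \<otimes>\<^bsub>twisted_monoid_ring S m e \<sigma> \<delta>\<^esub> (g - g') =
      f \<otimes>\<^bsub>twisted_monoid_ring S m e \<sigma> \<delta>\<^esub> g - f \<otimes>\<^bsub>twisted_monoid_ring S m e \<sigma> \<delta>\<^esub> g'"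
  by (simp_all add: twisted_monoid_ring_def frag_extend_diff frag_extend_diff_fun)

lemma twisted_mult_zero [simp]:
  "0 \<otimes>\<^bsub>twisted_monoid_ring S m e \<sigma> \<delta>\<^esub> g = 0" "f \<otimes>\<^bsub>twisted_monoid_ring S m e \<sigma> \<delta>\<^esub> 0 = 0"
  by (simp_all add: twisted_monoid_ring_def frag_extend_eq_0)

lemma twisted_mult_of [simp]:
  "frag_of s \<otimes>\<^bsub>twisted_monoid_ring S m e \<sigma> \<delta>\<^esub> frag_of t = frag_cmul (\<sigma> s t) (frag_of (m s t))"
  by (simp add: twisted_monoid_ring_def)

lemma twisted_mult_cmul:
  "frag_cmul c (frag_of s) \<otimes>\<^bsub>twisted_monoid_ring S m e \<sigma> \<delta>\<^esub> g =
    frag_cmul c (frag_of s \<otimes>\<^bsub>twisted_monoid_ring S m e \<sigma> \<delta>\<^esub> g)"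
  "frag_of s \<otimes>\<^bsub>twisted_monoid_ring S m e \<sigma> \<delta>\<^esub> frag_cmul c g =
    frag_cmul c (frag_of s \<otimes>\<^bsub>twisted_monoid_ring S m e \<sigma> \<delta>\<^esub> g)"
  by (simp_all add: twisted_monoid_ring_def frag_extend_cmul)

lemma keys_diff_subset: "Poly_Mapping.keys f \<subseteq> S \<Longrightarrow> Poly_Mapping.keys g \<subseteq> S \<Longrightarrow>
    Poly_Mapping.keys (f - g :: 's \<Rightarrow>\<^sub>0 int) \<subseteq> S"
  using keys_diff[of f g] by blast

lemma twisted_mult_keys:
  assumes f: "Poly_Mapping.keys f \<subseteq> U" and g: "Poly_Mapping.keys g \<subseteq> V"
    and m: "\<And>s t. \<lbrakk>s \<in> U; t \<in> V\<rbrakk> \<Longrightarrow> m s t \<in> W"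
  shows "Poly_Mapping.keys (f \<otimes>\<^bsub>twisted_monoid_ring S m e \<sigma> \<delta>\<^esub> g) \<subseteq> W"
proof -
  have basis: "Poly_Mapping.keys (frag_of s \<otimes>\<^bsub>twisted_monoid_ring S m e \<sigma> \<delta>\<^esub> g) \<subseteq> W"
    if s: "s \<in> U" for s
    using g
  proof (induction rule: frag_within_induct)
    case (basis t)
    then show ?case using m[OF s] keys_cmul[of "\<sigma> s t" "frag_of (m s t)"] by auto
  qed (simp_all add: twisted_mult_diff keys_diff_subset)
  show ?thesis
    using f
    by (induction rule: frag_within_induct)
      (simp_all add: twisted_mult_diff basis keys_diff_subset)
qed

text \<open>The identity \<open>cocycle\<close> is what associativity of the product
  \<open>s \<cdot> t = \<sigma> s t (m s t)\<close> amounts to on basis elements. Both the noncommutative polynomial ring and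
  the ring of tensor symbols with its Koszul signs are instances.\<close>

locale twisted_monoid =
  fixes S :: "'s set" and m e and \<sigma> :: "'s \<Rightarrow> 's \<Rightarrow> int" and \<delta> :: "'s \<Rightarrow> int"
  assumes m_closed: "\<lbrakk>s \<in> S; t \<in> S\<rbrakk> \<Longrightarrow> m s t \<in> S" and e_closed: "e \<in> S"
    and m_assoc: "\<lbrakk>s \<in> S; t \<in> S; r \<in> S\<rbrakk> \<Longrightarrow> m (m s t) r = m s (m t r)"
    and unit: "s \<in> S \<Longrightarrow> m e s = s" "s \<in> S \<Longrightarrow> m s e = s"
    and sign_unit: "s \<in> S \<Longrightarrow> \<sigma> e s = 1" "s \<in> S \<Longrightarrow> \<sigma> s e = 1"
    and cocycle: "\<lbrakk>s \<in> S; t \<in> S; r \<in> S\<rbrakk> \<Longrightarrow> \<sigma> s t * \<sigma> (m s t) r = \<sigma> t r * \<sigma> s (m t r)"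
    and degree_unit: "\<delta> e = 0" and degree_mult: "\<lbrakk>s \<in> S; t \<in> S\<rbrakk> \<Longrightarrow> \<delta> (m s t) = \<delta> s + \<delta> t"
begin

abbreviation "R \<equiv> twisted_monoid_ring S m e \<sigma> \<delta>"

lemma twisted_mult_homog:
  assumes "f \<in> homog R i" "g \<in> homog R j"
  shows "f \<otimes>\<^bsub>R\<^esub> g \<in> homog R (i + j)"
  using twisted_mult_keys[of f "{s \<in> S. \<delta> s = i}" g "{s \<in> S. \<delta> s = j}" m "{s \<in> S. \<delta> s = i + j}"]
    assms by (simp add: m_closed degree_mult)

lemma twisted_mult_closed:
  assumes "f \<in> carrier R" "g \<in> carrier R"
  shows "f \<otimes>\<^bsub>R\<^esub> g \<in> carrier R"
  using twisted_mult_keys[of f S g S m S] assms by (simp add: m_closed)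

text \<open>The product is biadditive, so associativity is checked on basis elements, one factor at a time.\<close>

lemma twisted_mult_assoc:
  assumes "f \<in> carrier R" "g \<in> carrier R" "h \<in> carrier R"
  shows "f \<otimes>\<^bsub>R\<^esub> g \<otimes>\<^bsub>R\<^esub> h = f \<otimes>\<^bsub>R\<^esub> (g \<otimes>\<^bsub>R\<^esub> h)"
proof -
  have keys: "Poly_Mapping.keys f \<subseteq> S" "Poly_Mapping.keys g \<subseteq> S" "Poly_Mapping.keys h \<subseteq> S"
    using assms by simp_all
  have basis3: "frag_of s \<otimes>\<^bsub>R\<^esub> frag_of t \<otimes>\<^bsub>R\<^esub> frag_of r = frag_of s \<otimes>\<^bsub>R\<^esub> (frag_of t \<otimes>\<^bsub>R\<^esub> frag_of r)"
    if "s \<in> S" "t \<in> S" "r \<in> S" for s t r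
    using that by (simp add: twisted_mult_cmul m_assoc cocycle)
  have basis2: "frag_of s \<otimes>\<^bsub>R\<^esub> frag_of t \<otimes>\<^bsub>R\<^esub> h = frag_of s \<otimes>\<^bsub>R\<^esub> (frag_of t \<otimes>\<^bsub>R\<^esub> h)"
    if st: "s \<in> S" "t \<in> S" for s t
    using keys(3)
  proof (induction rule: frag_within_induct)
    case (diff x y)
    then show ?case by (simp only: twisted_mult_diff)
  qed (simp_all only: basis3 st twisted_mult_zero)
  have basis1: "frag_of s \<otimes>\<^bsub>R\<^esub> g \<otimes>\<^bsub>R\<^esub> h = frag_of s \<otimes>\<^bsub>R\<^esub> (g \<otimes>\<^bsub>R\<^esub> h)" if s: "s \<in> S" for s
    using keys(2)
  proof (induction rule: frag_within_induct)
    case (diff x y)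
    then show ?case by (simp only: twisted_mult_diff)
  qed (simp_all only: basis2 s twisted_mult_zero)
  show ?thesis
    using keys(1)
  proof (induction rule: frag_within_induct)
    case (diff x y)
    then show ?case by (simp only: twisted_mult_diff)
  qed (simp_all only: basis1 twisted_mult_zero)
qed

lemma ring_twisted_monoid_ring: "ring R"
proof (rule ringI)
  show "abelian_group R"
  proof (rule abelian_groupI)
    fix x y assume "x \<in> carrier R" "y \<in> carrier R"
    then show "x \<oplus>\<^bsub>R\<^esub> y \<in> carrier R" using keys_add[of x y] by auto
  next
    fix x assume "x \<in> carrier R"
    then show "\<exists>y\<in>carrier R. y \<oplus>\<^bsub>R\<^esub> x = \<zero>\<^bsub>R\<^esub>"
      by (intro bexI[of _ "- x"]) simp_all
  qed (simp_all add: add_ac)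
next
  show "monoid R"
  proof (rule monoidI)
    fix x assume "x \<in> carrier R"
    then have x: "Poly_Mapping.keys x \<subseteq> S" by simp
    show "\<one>\<^bsub>R\<^esub> \<otimes>\<^bsub>R\<^esub> x = x" "x \<otimes>\<^bsub>R\<^esub> \<one>\<^bsub>R\<^esub> = x"
      using x by (induction rule: frag_within_induct)
        (simp_all add: twisted_mult_diff unit sign_unit)
  next
    fix x y assume "x \<in> carrier R" "y \<in> carrier R"
    then show "x \<otimes>\<^bsub>R\<^esub> y \<in> carrier R" by (rule twisted_mult_closed)
  next
    fix x y z assume "x \<in> carrier R" "y \<in> carrier R" "z \<in> carrier R"
    then show "x \<otimes>\<^bsub>R\<^esub> y \<otimes>\<^bsub>R\<^esub> z = x \<otimes>\<^bsub>R\<^esub> (y \<otimes>\<^bsub>R\<^esub> z)" by (rule twisted_mult_assoc)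
  qed (simp add: e_closed)
next
  have add: "f + g = f - (0 - g)" for f g :: "'s \<Rightarrow>\<^sub>0 int" by simp
  fix x y z
  show "(x \<oplus>\<^bsub>R\<^esub> y) \<otimes>\<^bsub>R\<^esub> z = x \<otimes>\<^bsub>R\<^esub> z \<oplus>\<^bsub>R\<^esub> y \<otimes>\<^bsub>R\<^esub> z"
    "z \<otimes>\<^bsub>R\<^esub> (x \<oplus>\<^bsub>R\<^esub> y) = z \<otimes>\<^bsub>R\<^esub> x \<oplus>\<^bsub>R\<^esub> z \<otimes>\<^bsub>R\<^esub> y"
    by (simp_all only: twisted_monoid_ring_simps add twisted_mult_diff twisted_mult_zero)
qed

lemma homog_induct [consumes 1, case_names zero basis diff]:
  assumes "f \<in> homog R i" and "P 0" and "\<And>s. \<lbrakk>s \<in> S; \<delta> s = i\<rbrakk> \<Longrightarrow> P (frag_of s)"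
    and "\<And>f g. \<lbrakk>f \<in> homog R i; g \<in> homog R i; P f; P g\<rbrakk> \<Longrightarrow> P (f - g)"
  shows "P f"
  by (rule free_Abelian_group_induct[of f "{s \<in> S. \<delta> s = i}"]) (use assms in auto)

lemma twisted_diff: 
  assumes "f \<in> carrier R" "g \<in> carrier R" shows "f \<ominus>\<^bsub>R\<^esub> g = f - g"
proof -
  interpret ring R by (rule ring_twisted_monoid_ring)
  have "- g \<oplus>\<^bsub>R\<^esub> g = \<zero>\<^bsub>R\<^esub>" "- g \<in> carrier R" using assms by simp_all
  then have "\<ominus>\<^bsub>R\<^esub> g = - g" using assms by (intro minus_equality)
  then show ?thesis by (simp add: minus_eq)
qed

text \<open>The underlying group is free abelian on \<open>S\<close>, so \<open>h\<close> extends additively; by biadditivity the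
  extension is multiplicative because it is so on basis elements.\<close>

lemma twisted_monoid_ring_universal:
  assumes "ring Q" and closed: "\<And>s. s \<in> S \<Longrightarrow> h s \<in> carrier Q" and one: "h e = \<one>\<^bsub>Q\<^esub>"
    and mult: "\<And>s t. \<lbrakk>s \<in> S; t \<in> S\<rbrakk> \<Longrightarrow> h s \<otimes>\<^bsub>Q\<^esub> h t = [\<sigma> s t] \<cdot>\<^bsub>Q\<^esub> h (m s t)"
  obtains F where "F \<in> ring_hom R Q" "\<And>s. s \<in> S \<Longrightarrow> F (frag_of s) = h s"
proof -
  interpret Q: ring Q by fact
  interpret R: ring R by (rule ring_twisted_monoid_ring)
  obtain F where F: "F \<in> hom (free_Abelian_group S) (add_monoid Q)"
    and F_of: "\<And>s. s \<in> S \<Longrightarrow> F (frag_of s) = h s"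
    using comm_group.free_Abelian_group_universal[OF Q.a_comm_group, of h S] closed by auto
  interpret F: group_hom "free_Abelian_group S" "add_monoid Q" F
    by (intro group_hom.intro group_hom_axioms.intro group_free_Abelian_group Q.a_group F)
  have closedF: "F f \<in> carrier Q" if "Poly_Mapping.keys f \<subseteq> S" for f
    using F.hom_closed[of f] that by simp
  have addF: "F (f + g) = F f \<oplus>\<^bsub>Q\<^esub> F g"
    if "Poly_Mapping.keys f \<subseteq> S" "Poly_Mapping.keys g \<subseteq> S" for f g
    using F.hom_mult[of f g] that by simp
  have diffF: "F (f - g) = F f \<ominus>\<^bsub>Q\<^esub> F g"
    if "Poly_Mapping.keys f \<subseteq> S" "Poly_Mapping.keys g \<subseteq> S" for f g
    using addF[of f "- g"] F.hom_inv[of g] that by (simp add: Q.minus_eq a_inv_def)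
  have zeroF: "F 0 = \<zero>\<^bsub>Q\<^esub>" using F.hom_one by simp
  have cmulF: "F (frag_cmul c (frag_of s)) = [c] \<cdot>\<^bsub>Q\<^esub> h s" if "s \<in> S" for c s
    using F.hom_int_pow[of "frag_of s" c] that by (simp add: F_of add_pow_def)
  have F_basis_mult: "F (frag_of s \<otimes>\<^bsub>R\<^esub> g) = F (frag_of s) \<otimes>\<^bsub>Q\<^esub> F g"
    if s: "s \<in> S" and g: "Poly_Mapping.keys g \<subseteq> S" for s g
    using g
  proof (induction rule: frag_within_induct)
    case zero
    then show ?case using s by (simp add: zeroF F_of closed)
  next
    case (diff x y)
    then have "Poly_Mapping.keys (frag_of s \<otimes>\<^bsub>R\<^esub> x) \<subseteq> S" "Poly_Mapping.keys (frag_of s \<otimes>\<^bsub>R\<^esub> y) \<subseteq> S"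
      using twisted_mult_closed[of "frag_of s"] s by auto
    with diff s show ?case
      by (simp add: twisted_mult_diff diffF F_of closed closedF Q.minus_eq Q.r_distr Q.r_minus)
  next
    case (basis t)
    then show ?case using s by (simp add: cmulF m_closed F_of mult)
  qed
  have "F \<in> ring_hom R Q"
  proof (rule ring_hom_memI)
    fix f g assume fg: "f \<in> carrier R" "g \<in> carrier R"
    then have g: "Poly_Mapping.keys g \<subseteq> S" and "Poly_Mapping.keys f \<subseteq> S" by simp_all
    then show "F (f \<oplus>\<^bsub>R\<^esub> g) = F f \<oplus>\<^bsub>Q\<^esub> F g" by (simp add: addF)
    show "F (f \<otimes>\<^bsub>R\<^esub> g) = F f \<otimes>\<^bsub>Q\<^esub> F g"
      using \<open>Poly_Mapping.keys f \<subseteq> S\<close>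
    proof (induction rule: frag_within_induct)
      case zero
      then show ?case using g by (simp add: zeroF closedF)
    next
      case (diff x y)
      then have "Poly_Mapping.keys (x \<otimes>\<^bsub>R\<^esub> g) \<subseteq> S" "Poly_Mapping.keys (y \<otimes>\<^bsub>R\<^esub> g) \<subseteq> S"
        using twisted_mult_closed[of _ g] g by auto
      with diff g show ?case
        by (simp add: twisted_mult_diff diffF closedF Q.minus_eq Q.l_distr Q.l_minus)
    next
      case (basis s)
      then show ?case using F_basis_mult g by simp
    qed
  qed (auto simp: closedF F_of e_closed one)
  with F_of that show thesis by blast
qed

end

section \<open>Graded rings without the directness of the sum\<close>

text \<open>Quotients inherit this structure from the ring, whichever ideal is divided out. The generation and
  extension results below are stated for it, since they only concern products of homogeneous
  elements.\<close>

locale weakly_graded_ring = ring R for R :: "('a, 'm) graded_ring_scheme" (structure) +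
  assumes homog_subgroup: "additive_subgroup (homog R i) R"
    and homog_one: "\<one> \<in> homog R 0"
    and homog_mult: "\<lbrakk>a \<in> homog R i; b \<in> homog R j\<rbrakk> \<Longrightarrow> a \<otimes> b \<in> homog R (i + j)"
begin

lemma homog_closed: "a \<in> homog R i \<Longrightarrow> a \<in> carrier R"
  by (rule additive_subgroup.a_Hcarr[OF homog_subgroup])

lemma homog_add: "\<lbrakk>a \<in> homog R i; b \<in> homog R i\<rbrakk> \<Longrightarrow> a \<oplus> b \<in> homog R i"
  by (rule additive_subgroup.a_closed[OF homog_subgroup])

lemma homog_zero: "\<zero> \<in> homog R i"
  by (rule additive_subgroup.zero_closed[OF homog_subgroup])

lemma homog_diff: "\<lbrakk>a \<in> homog R i; b \<in> homog R i\<rbrakk> \<Longrightarrow> a \<ominus> b \<in> homog R i"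
  by (rule additive_subgroup.diff_closed[OF homog_subgroup])

end

lemma (in graded_ring) weakly_graded: "weakly_graded_ring R"
  by (intro weakly_graded_ring.intro weakly_graded_ring_axioms.intro ring_axioms
      homog_subgroup homog_one homog_mult)

lemma (in ring) koszul_sign_smult:
  "x \<in> carrier R \<Longrightarrow> [koszul_sign n] \<cdot> x = (if even n then x else \<ominus> x)"
  by (cases "even n") (simp_all add: koszul_sign_def add_pow_int_ge add_pow_int_lt)

lemma koszul_sign_simps: "koszul_sign 0 = 1" "koszul_sign a * koszul_sign b = koszul_sign (a + b)"
  by (auto simp: koszul_sign_def)

definition graded_ring_hom ::
    "('a, 'm) graded_ring_scheme \<Rightarrow> ('b, 'n) graded_ring_scheme \<Rightarrow> ('a \<Rightarrow> 'b) set" where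
  "graded_ring_hom R S = {h \<in> ring_hom R S. \<forall>i. h ` homog R i \<subseteq> homog S i}"

lemma graded_ring_homD:
  assumes "h \<in> graded_ring_hom R S"
  shows "h \<in> ring_hom R S" "a \<in> homog R i \<Longrightarrow> h a \<in> homog S i"
  using assms by (auto simp: graded_ring_hom_def)

context twisted_monoid
begin

lemma weakly_graded_twisted_monoid_ring: "weakly_graded_ring R"
proof -
  interpret ring R by (rule ring_twisted_monoid_ring)
  show ?thesis
  proof (intro weakly_graded_ring.intro weakly_graded_ring_axioms.intro)
    show "ring R" by (rule ring_twisted_monoid_ring)
  next
    fix i show "additive_subgroup (homog R i) R"
    proof (rule additive_subgroup_diffI)
      fix x y assume "x \<in> homog R i" "y \<in> homog R i"
      moreover from this have "x \<ominus>\<^bsub>R\<^esub> y = x - y" by (intro twisted_diff) auto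
      ultimately show "x \<ominus>\<^bsub>R\<^esub> y \<in> homog R i" by (simp add: keys_diff_subset)
    qed auto
  next
    show "\<one>\<^bsub>R\<^esub> \<in> homog R 0" by (simp add: e_closed degree_unit)
  next
    fix a b i j assume "a \<in> homog R i" "b \<in> homog R j"
    then show "a \<otimes>\<^bsub>R\<^esub> b \<in> homog R (i + j)" by (rule twisted_mult_homog)
  qed
qed

lemma graded_hom_on_basis:
  assumes "weakly_graded_ring Q" and F: "F \<in> ring_hom R Q"
    and basis: "\<And>s. s \<in> S \<Longrightarrow> F (frag_of s) \<in> homog Q (\<delta> s)"
  shows "F \<in> graded_ring_hom R Q"
proof -
  interpret Q: weakly_graded_ring Q by fact
  interpret F: ring_hom_ring R Q F
    by (intro ring_hom_ringI2 ring_twisted_monoid_ring F Q.ring_axioms)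
  have "F f \<in> homog Q i" if "f \<in> homog R i" for f i
    using that
  proof (induction rule: homog_induct)
    case zero
    then show ?case using F.hom_zero Q.homog_zero by simp
  next
    case (basis s)
    then show ?case using assms(3) by blast
  next
    case (diff f g)
    then have "f \<in> carrier R" "g \<in> carrier R" by auto
    then have "F (f - g) = F f \<ominus>\<^bsub>Q\<^esub> F g"
      using F.hom_diff[of f g] by (simp only: twisted_diff)
    then show ?case using diff Q.homog_diff by simp
  qed
  then show ?thesis using F by (auto simp: graded_ring_hom_def)
qed

lemma homog_span: "homog R k \<subseteq> generate (add_monoid R) (frag_of ` {s \<in> S. \<delta> s = k})"
proof
  interpret ring R by (rule ring_twisted_monoid_ring)
  have sub: "additive_subgroup (generate (add_monoid R) (frag_of ` {s \<in> S. \<delta> s = k})) R"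
    by (rule additive_span_subgroup) auto
  fix f assume "f \<in> homog R k"
  then show "f \<in> generate (add_monoid R) (frag_of ` {s \<in> S. \<delta> s = k})"
  proof (induction rule: homog_induct)
    case zero
    then show ?case using additive_subgroup.zero_closed[OF sub] by (simp only: twisted_monoid_ring_simps(3))
  next
    case (basis s)
    then show ?case by (auto intro: generate.incl)
  next
    case (diff f g)
    then have eq: "f - g = f \<ominus>\<^bsub>R\<^esub> g" by (intro twisted_diff[symmetric]) auto
    show ?case
      unfolding eq by (rule additive_subgroup.diff_closed[OF sub diff(3,4)])
  qed
qed

end

section \<open>Quotients\<close>

lemma graded_quotient_simps:
  "carrier (graded_quotient R I) = carrier (R Quot I)"
  "a \<otimes>\<^bsub>graded_quotient R I\<^esub> b = a \<otimes>\<^bsub>R Quot I\<^esub> b"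
  "\<one>\<^bsub>graded_quotient R I\<^esub> = \<one>\<^bsub>R Quot I\<^esub>"
  "\<zero>\<^bsub>graded_quotient R I\<^esub> = \<zero>\<^bsub>R Quot I\<^esub>"
  "a \<oplus>\<^bsub>graded_quotient R I\<^esub> b = a \<oplus>\<^bsub>R Quot I\<^esub> b"
  "homog (graded_quotient R I) i = (\<lambda>x. I +>\<^bsub>R\<^esub> x) ` homog R i"
  by (simp_all add: graded_quotient_def ring.defs graded_ring.defs)

text \<open>Transfers the ring structure between records that differ only in their extension fields.\<close>

lemma ring_cong:
  assumes "ring R" and "carrier S = carrier R" "\<one>\<^bsub>S\<^esub> = \<one>\<^bsub>R\<^esub>" "\<zero>\<^bsub>S\<^esub> = \<zero>\<^bsub>R\<^esub>"
    "\<And>a b. a \<otimes>\<^bsub>S\<^esub> b = a \<otimes>\<^bsub>R\<^esub> b" "\<And>a b. a \<oplus>\<^bsub>S\<^esub> b = a \<oplus>\<^bsub>R\<^esub> b"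
  shows "ring S"
proof -
  interpret ring R by fact
  show ?thesis
  proof (rule ringI)
    show "abelian_group S"
    proof (rule abelian_groupI)
      fix x assume "x \<in> carrier S"
      then show "\<exists>y\<in>carrier S. y \<oplus>\<^bsub>S\<^esub> x = \<zero>\<^bsub>S\<^esub>"
        using assms l_neg a_inv_closed by metis
    qed (simp_all add: assms a_ac)
    show "monoid S"
      by (rule monoidI) (simp_all add: assms m_assoc)
  qed (simp_all add: assms l_distr r_distr)
qed

lemma (in ring_hom_ring) image_additive_subgroup:
  assumes "additive_subgroup H R"
  shows "additive_subgroup (h ` H) S"
proof (rule S.additive_subgroup_diffI)
  interpret H: additive_subgroup H R by fact
  show "h ` H \<subseteq> carrier S" using H.a_Hcarr by auto
  show "\<zero>\<^bsub>S\<^esub> \<in> h ` H" using H.zero_closed hom_zero by (metis image_eqI)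
  fix x y assume "x \<in> h ` H" "y \<in> h ` H"
  then obtain a b where ab: "a \<in> H" "b \<in> H" "x = h a" "y = h b" by blast
  then have "x \<ominus>\<^bsub>S\<^esub> y = h (a \<ominus> b)" by (simp add: hom_diff)
  then show "x \<ominus>\<^bsub>S\<^esub> y \<in> h ` H"
    using H.diff_closed[OF ab(1,2)] by simp
qed

lemma graded_quotient_projection:
  fixes R :: "('a, 'm) graded_ring_scheme" (structure)
  assumes "weakly_graded_ring R" and "ideal I R"
  shows "weakly_graded_ring (graded_quotient R I)"
    and "(+>) I \<in> ring_hom R (graded_quotient R I)"
    and "(+>) I ` carrier R = carrier (graded_quotient R I)"
    and "\<And>x. x \<in> carrier R \<Longrightarrow> I +> x = \<zero>\<^bsub>graded_quotient R I\<^esub> \<longleftrightarrow> x \<in> I"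
proof -
  let ?Q = "graded_quotient R I"
  interpret weakly_graded_ring R by fact
  interpret ideal I R by fact
  have ring: "ring ?Q"
    by (rule ring_cong[OF quotient_is_ring]) (simp_all add: graded_quotient_simps)
  show hom: "(+>) I \<in> ring_hom R ?Q"
    using rcos_ring_hom by (simp add: ring_hom_def graded_quotient_simps)
  interpret p: ring_hom_ring R ?Q "(+>) I"
    by (intro ring_hom_ringI2 ring hom ring_axioms)
  show "(+>) I ` carrier R = carrier ?Q"
    unfolding graded_quotient_simps FactRing_def partial_object.simps A_RCOSETS_def' by blast
  have zero: "\<zero>\<^bsub>?Q\<^esub> = I" by (simp only: graded_quotient_simps FactRing_def ring.simps)
  show "I +> x = \<zero>\<^bsub>?Q\<^esub> \<longleftrightarrow> x \<in> I" if "x \<in> carrier R" for x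
    unfolding zero using a_rcos_const[of x] a_rcos_self[OF that] by metis
  show "weakly_graded_ring ?Q"
  proof (intro weakly_graded_ring.intro weakly_graded_ring_axioms.intro)
    show "ring ?Q" by (rule ring)
    show "additive_subgroup (homog ?Q i) ?Q" for i
      using p.image_additive_subgroup[OF homog_subgroup[of i]] by (simp add: graded_quotient_simps(6))
    show "\<one>\<^bsub>?Q\<^esub> \<in> homog ?Q 0"
      unfolding graded_quotient_simps(6) using homog_one p.hom_one by (metis image_eqI)
    fix a b i j assume "a \<in> homog ?Q i" "b \<in> homog ?Q j"
    then obtain x y where "x \<in> homog R i" "y \<in> homog R j" "a = I +> x" "b = I +> y"
      by (auto simp: graded_quotient_simps(6))
    then show "a \<otimes>\<^bsub>?Q\<^esub> b \<in> homog ?Q (i + j)"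
      using homog_mult[of x i y j] p.hom_mult[of x y] homog_closed
      by (metis graded_quotient_simps(6) image_eqI)
  qed
qed

section \<open>Polynomial rings\<close>

definition word_value :: "('r, 'm) ring_scheme \<Rightarrow> ('g \<Rightarrow> 'r) \<Rightarrow> 'g list \<Rightarrow> 'r" where
  "word_value R y w = foldr (\<lambda>g. mult R (y g)) w \<one>\<^bsub>R\<^esub>"

abbreviation word_degree :: "(int \<times> 'x) list \<Rightarrow> int" where
  "word_degree w \<equiv> sum_list (map fst w)"

lemma word_value_simps [simp]:
  "word_value R y [] = \<one>\<^bsub>R\<^esub>"
  "word_value R y (g # w) = y g \<otimes>\<^bsub>R\<^esub> word_value R y w"
  by (simp_all add: word_value_def)

lemma (in weakly_graded_ring) word_value_homog:
  assumes "w \<in> lists G" and "\<And>g. g \<in> G \<Longrightarrow> y g \<in> homog R (fst g)"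
  shows "word_value R y w \<in> homog R (word_degree w)"
  using assms(1) by (induction w) (auto intro: homog_one homog_mult assms(2))

lemma (in ring) word_value_closed:
  assumes "w \<in> lists G" and "\<And>g. g \<in> G \<Longrightarrow> y g \<in> carrier R"
  shows "word_value R y w \<in> carrier R"
  using assms(1) by (induction w) (auto simp: assms(2))

lemma (in ring) word_value_append:
  assumes "v \<in> lists G" "w \<in> lists G" and "\<And>g. g \<in> G \<Longrightarrow> y g \<in> carrier R"
  shows "word_value R y (v @ w) = word_value R y v \<otimes> word_value R y w"
proof -
  have closed: "word_value R y v \<in> carrier R" if "v \<in> lists G" for v
    by (rule word_value_closed[OF that assms(3)])
  show ?thesis
    using assms(1) by (induction v) (auto simp: m_assoc assms(3) closed assms(2))
qed

lemma (in ring_hom_ring) hom_word_value: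
  assumes "w \<in> lists G" and "\<And>g. g \<in> G \<Longrightarrow> y g \<in> carrier R"
    and "\<And>g. g \<in> G \<Longrightarrow> h (y g) = z g"
  shows "h (word_value R y w) = word_value S z w"
  using assms(1)
proof (induction w)
  case (Cons g w)
  then show ?case using R.word_value_closed[OF Cons(2) assms(2)] assms by simp
qed simp

text \<open>A pair \<open>(i, x)\<close> in \<open>G\<close> is a generator of degree \<open>i\<close>, as in the definition of polynomial rings.\<close>

definition word_generated ::
    "('p, 'n) graded_ring_scheme \<Rightarrow> (int \<times> 'x) set \<Rightarrow> (int \<times> 'x \<Rightarrow> 'p) \<Rightarrow> bool" where
  "word_generated P G y \<longleftrightarrow>
    (\<forall>g\<in>G. y g \<in> homog P (fst g)) \<and>
    (\<forall>k. homog P k \<subseteq> generate (add_monoid P) {word_value P y w | w. w \<in> lists G \<and> word_degree w = k})"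

text \<open>The existence half of the universal property of a free graded ring, tested on the single target
  \<open>C\<close>. The target is a parameter because \<open>\<int>[X]\<close> has the property only for graded
  commutative targets whose odd elements square to zero.\<close>

definition free_for ::
    "('p, 'n) graded_ring_scheme \<Rightarrow> (int \<times> 'x) set \<Rightarrow> (int \<times> 'x \<Rightarrow> 'p) \<Rightarrow>
      ('c, 'm) graded_ring_scheme \<Rightarrow> bool" where
  "free_for P G y C \<longleftrightarrow>
    (\<forall>f. (\<forall>g\<in>G. f g \<in> homog C (fst g)) \<longrightarrow>
      (\<exists>h\<in>graded_ring_hom P C. \<forall>g\<in>G. h (y g) = f g))"

lemma twisted_monoid_words: "twisted_monoid (lists G) (@) [] (\<lambda>_ _. 1) word_degree"
  by unfold_locales auto

lemma weakly_graded_noncomm_polynomial_ring: "weakly_graded_ring (noncomm_polynomial_ring X)"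
  unfolding noncomm_polynomial_ring_def
  by (rule twisted_monoid.weakly_graded_twisted_monoid_ring[OF twisted_monoid_words])

lemma noncomm_word_value:
  "word_value (noncomm_polynomial_ring X) (\<lambda>g. frag_of [g]) w = frag_of w"
  by (induction w) (simp_all add: noncomm_polynomial_ring_def)

lemma noncomm_word_generated:
  "word_generated (noncomm_polynomial_ring X) (Sigma UNIV X) (\<lambda>g. frag_of [g])"
proof -
  have "{word_value (noncomm_polynomial_ring X) (\<lambda>g. frag_of [g]) w |w.
        w \<in> lists (Sigma UNIV X) \<and> word_degree w = k} =
      frag_of ` {w \<in> lists (Sigma UNIV X). word_degree w = k}" for k
    by (auto simp: noncomm_word_value)
  moreover have "frag_of [g] \<in> homog (noncomm_polynomial_ring X) (fst g)" if "g \<in> Sigma UNIV X" for g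
    using that by (auto simp: noncomm_polynomial_ring_def)
  ultimately show ?thesis
    unfolding word_generated_def noncomm_polynomial_ring_def
    using twisted_monoid.homog_span[OF twisted_monoid_words] by fastforce
qed

lemma noncomm_free_for:
  assumes "weakly_graded_ring C"
  shows "free_for (noncomm_polynomial_ring X) (Sigma UNIV X) (\<lambda>g. frag_of [g]) C"
  unfolding free_for_def
proof (intro allI impI)
  interpret C: weakly_graded_ring C by fact
  fix f assume f: "\<forall>g\<in>Sigma UNIV X. f g \<in> homog C (fst g)"
  interpret W: twisted_monoid "lists (Sigma UNIV X)" "(@)" "[]" "\<lambda>_ _. 1" word_degree
    by (rule twisted_monoid_words)
  have fc: "\<And>g. g \<in> Sigma UNIV X \<Longrightarrow> f g \<in> carrier C" using f C.homog_closed by blast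
  obtain F where F: "F \<in> ring_hom W.R C"
    and F_of: "\<And>w. w \<in> lists (Sigma UNIV X) \<Longrightarrow> F (frag_of w) = word_value C f w"
  proof (rule W.twisted_monoid_ring_universal[OF C.ring_axioms, of "word_value C f"])
    fix v w assume v: "v \<in> lists (Sigma UNIV X)" and w: "w \<in> lists (Sigma UNIV X)"
    show "word_value C f v \<in> carrier C" by (rule C.word_value_closed[OF v fc])
    show "word_value C f v \<otimes>\<^bsub>C\<^esub> word_value C f w = [(1::int)] \<cdot>\<^bsub>C\<^esub> word_value C f (v @ w)"
      using C.word_value_append[OF v w fc] C.word_value_closed[OF v fc] C.word_value_closed[OF w fc] by simp
  qed auto
  have "F \<in> graded_ring_hom W.R C"
    by (rule W.graded_hom_on_basis[OF assms F]) (use f in \<open>auto simp: F_of intro!: C.word_value_homog\<close>)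
  moreover have "F (frag_of [g]) = f g" if "g \<in> Sigma UNIV X" for g
    using F_of[of "[g]"] that fc by simp
  ultimately show "\<exists>h\<in>graded_ring_hom (noncomm_polynomial_ring X) C.
      \<forall>g\<in>Sigma UNIV X. h (frag_of [g]) = f g"
    unfolding noncomm_polynomial_ring_def by blast
qed

lemma comm_polynomial_relations_carrier:
  "comm_polynomial_relations X \<subseteq> carrier (noncomm_polynomial_ring X)"
proof
  fix r assume "r \<in> comm_polynomial_relations X"
  then consider (comm) i j x y where "x \<in> X i" "y \<in> X j"
      "r = frag_of [(j, y), (i, x)] - frag_cmul (koszul_sign (i * j)) (frag_of [(i, x), (j, y)])"
    | (square) k z where "z \<in> X k" "r = frag_of [(k, z), (k, z)]"
    unfolding comm_polynomial_relations_def by blast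
  then show "r \<in> carrier (noncomm_polynomial_ring X)"
  proof cases
    case comm
    have "Poly_Mapping.keys r \<subseteq> lists (Sigma UNIV X)"
      unfolding comm(3) using comm(1,2)
      by (intro keys_diff_subset order_trans[OF keys_cmul]) auto
    then show ?thesis by (simp add: noncomm_polynomial_ring_def)
  next
    case square
    then show ?thesis by (simp add: noncomm_polynomial_ring_def)
  qed
qed

lemma comm_polynomial_projection:
  fixes X :: "int \<Rightarrow> 'x set"
  defines "N \<equiv> noncomm_polynomial_ring X"
  defines "I \<equiv> Idl\<^bsub>N\<^esub> (comm_polynomial_relations X)"
  shows "ideal I N"
    and "weakly_graded_ring (comm_polynomial_ring X)"
    and "(+>\<^bsub>N\<^esub>) I \<in> ring_hom N (comm_polynomial_ring X)"
    and "(+>\<^bsub>N\<^esub>) I ` carrier N = carrier (comm_polynomial_ring X)"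
    and "\<And>x. x \<in> carrier N \<Longrightarrow> I +>\<^bsub>N\<^esub> x = \<zero>\<^bsub>comm_polynomial_ring X\<^esub> \<longleftrightarrow> x \<in> I"
    and "homog (comm_polynomial_ring X) k = (+>\<^bsub>N\<^esub>) I ` homog N k"
proof -
  interpret N: weakly_graded_ring N unfolding N_def by (rule weakly_graded_noncomm_polynomial_ring)
  have Q: "comm_polynomial_ring X = graded_quotient N I"
    unfolding comm_polynomial_ring_def N_def I_def ..
  show "ideal I N" unfolding I_def
    by (rule N.genideal_ideal) (simp only: N_def comm_polynomial_relations_carrier)
  note proj = graded_quotient_projection[OF N.weakly_graded_ring_axioms this]
  show "weakly_graded_ring (comm_polynomial_ring X)" unfolding Q by (rule proj(1))
  show "(+>\<^bsub>N\<^esub>) I \<in> ring_hom N (comm_polynomial_ring X)" unfolding Q by (rule proj(2))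
  show "(+>\<^bsub>N\<^esub>) I ` carrier N = carrier (comm_polynomial_ring X)" unfolding Q by (rule proj(3))
  show "\<And>x. x \<in> carrier N \<Longrightarrow> I +>\<^bsub>N\<^esub> x = \<zero>\<^bsub>comm_polynomial_ring X\<^esub> \<longleftrightarrow> x \<in> I"
    unfolding Q by (rule proj(4))
  show "homog (comm_polynomial_ring X) k = (+>\<^bsub>N\<^esub>) I ` homog N k"
    unfolding Q by (rule graded_quotient_simps(6))
qed

definition comm_variable :: "(int \<Rightarrow> 'x set) \<Rightarrow> int \<times> 'x \<Rightarrow> ((int \<times> 'x) list \<Rightarrow>\<^sub>0 int) set" where
  "comm_variable X g =
    (Idl\<^bsub>noncomm_polynomial_ring X\<^esub> (comm_polynomial_relations X)) +>\<^bsub>noncomm_polynomial_ring X\<^esub> frag_of [g]"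

text \<open>The commutative polynomial ring inherits its generation by words from the noncommutative one.\<close>

lemma word_generated_image:
  assumes "weakly_graded_ring R" "weakly_graded_ring S" and h: "h \<in> ring_hom R S"
    and homog: "\<And>k. homog S k = h ` homog R k"
    and gen: "word_generated R G y" and z: "\<And>g. g \<in> G \<Longrightarrow> h (y g) = z g"
  shows "word_generated S G z"
proof -
  interpret R: weakly_graded_ring R by fact
  interpret S: weakly_graded_ring S by fact
  interpret h: ring_hom_ring R S h by (intro ring_hom_ringI2 R.ring_axioms S.ring_axioms h)
  have y: "y g \<in> homog R (fst g)" if "g \<in> G" for g using gen that by (auto simp: word_generated_def)
  have yc: "y g \<in> carrier R" if "g \<in> G" for g by (rule R.homog_closed[OF y[OF that]])
  show ?thesis
    unfolding word_generated_def
  proof (intro conjI ballI allI)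
    show "z g \<in> homog S (fst g)" if "g \<in> G" for g
      using imageI[OF y[OF that], of h] z[OF that] homog[of "fst g"] by simp
    fix k
    let ?W = "{word_value R y w | w. w \<in> lists G \<and> word_degree w = k}"
    let ?V = "{word_value S z w | w. w \<in> lists G \<and> word_degree w = k}"
    have W: "?W \<subseteq> carrier R" by (auto intro!: R.word_value_closed[where G = G] yc)
    have V: "?V = h ` ?W" 
    proof -
      have "h (word_value R y w) = word_value S z w" if "w \<in> lists G" for w
        using h.hom_word_value[OF that yc z] .
      then have "word_value S z w = h (word_value R y w)" if "w \<in> lists G" for w
        using that by simp
      then show ?thesis unfolding setcompr_eq_image image_image by (intro image_cong) auto
    qed
    interpret g: group_hom "add_monoid R" "add_monoid S" h by (rule h.a_group_hom)
    have "homog S k \<subseteq> h ` generate (add_monoid R) ?W"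
      unfolding homog using gen by (intro image_mono) (simp add: word_generated_def)
    also have "\<dots> = generate (add_monoid S) ?V"
      unfolding V by (rule g.generate_img[symmetric]) (use W in simp)
    finally show "homog S k \<subseteq> generate (add_monoid S) ?V" .
  qed
qed

lemma comm_word_generated:
  "word_generated (comm_polynomial_ring X) (Sigma UNIV X) (comm_variable X)"
  by (rule word_generated_image[OF weakly_graded_noncomm_polynomial_ring comm_polynomial_projection(2,3,6)
        noncomm_word_generated]) (simp add: comm_variable_def)

text \<open>The extension of \<open>f\<close> to noncommutative polynomials kills the commutation relations, because the
  values of \<open>f\<close> commute up to sign, and the relations \<open>z\<^sup>2\<close>, because odd elements of \<open>C\<close> square to zero.
  The kernel is an ideal, so it contains the ideal that the relations generate.\<close>

lemma comm_free_for:
  fixes C :: "('c, 'm) graded_ring_scheme" (structure)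
  assumes "weakly_graded_ring C"
    and comm: "\<And>a b i j. \<lbrakk>a \<in> homog C i; b \<in> homog C j\<rbrakk> \<Longrightarrow> a \<otimes> b = [koszul_sign (i * j)] \<cdot> (b \<otimes> a)"
    and odd_square: "\<And>a i. \<lbrakk>a \<in> homog C i; odd i\<rbrakk> \<Longrightarrow> a \<otimes> a = \<zero>"
  shows "free_for (comm_polynomial_ring X) (Sigma UNIV X) (comm_variable X) C"
  unfolding free_for_def
proof (intro allI impI)
  let ?N = "noncomm_polynomial_ring X"
  let ?I = "Idl\<^bsub>?N\<^esub> (comm_polynomial_relations X)"
  interpret N: weakly_graded_ring ?N by (rule weakly_graded_noncomm_polynomial_ring)
  interpret C: weakly_graded_ring C by fact
  fix f assume f: "\<forall>g\<in>Sigma UNIV X. f g \<in> homog C (fst g)"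
  obtain F where F: "F \<in> graded_ring_hom ?N C" and F_var: "\<And>g. g \<in> Sigma UNIV X \<Longrightarrow> F (frag_of [g]) = f g"
    using noncomm_free_for[OF assms(1), of X] f unfolding free_for_def by blast
  interpret F: ring_hom_ring ?N C F
    by (intro ring_hom_ringI2 N.ring_axioms C.ring_axioms graded_ring_homD(1)[OF F])
  have carrier: "\<And>g. g \<in> Sigma UNIV X \<Longrightarrow> frag_of [g] \<in> carrier ?N"
    by (simp add: noncomm_polynomial_ring_def)
  have F_pair: "F (frag_of [g, g']) = f g \<otimes> f g'" and pair: "frag_of [g, g'] \<in> carrier ?N"
    if "g \<in> Sigma UNIV X" "g' \<in> Sigma UNIV X" for g g'
  proof -
    have "frag_of [g] \<otimes>\<^bsub>?N\<^esub> frag_of [g'] = frag_of [g, g']"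
      by (simp add: noncomm_polynomial_ring_def)
    then show "F (frag_of [g, g']) = f g \<otimes> f g'" "frag_of [g, g'] \<in> carrier ?N"
      using that carrier F.hom_mult[of "frag_of [g]" "frag_of [g']"]
        N.m_closed[of "frag_of [g]" "frag_of [g']"] by (simp_all add: F_var)
  qed
  have relations: "comm_polynomial_relations X \<subseteq> a_kernel ?N C F"
  proof
    fix r assume r: "r \<in> comm_polynomial_relations X"
    then have rc: "r \<in> carrier ?N" using comm_polynomial_relations_carrier by blast
    from r consider (comm) i j x y where "x \<in> X i" "y \<in> X j"
        "r = frag_of [(j, y), (i, x)] - frag_cmul (koszul_sign (i * j)) (frag_of [(i, x), (j, y)])"
      | (square) k z where "z \<in> X k" "odd k" "r = frag_of [(k, z), (k, z)]"
      unfolding comm_polynomial_relations_def by blast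
    then have "F r = \<zero>"
    proof cases
      case comm
      let ?p = "frag_of [(i, x), (j, y)]" and ?q = "frag_of [(j, y), (i, x)]"
      have g: "(i, x) \<in> Sigma UNIV X" "(j, y) \<in> Sigma UNIV X" using comm by auto
      then have fg: "f (i, x) \<in> homog C i" "f (j, y) \<in> homog C j" using f by force+
      have pq: "?p \<in> carrier ?N" "?q \<in> carrier ?N" using pair g by blast+
      have F_swap: "F ?q = [koszul_sign (i * j)] \<cdot> F ?p"
        using assms(2)[OF fg(2,1)] F_pair g by (simp add: mult.commute)
      show ?thesis
      proof (cases "even (i * j)")
        case True
        then have "r \<oplus>\<^bsub>?N\<^esub> ?p = ?q"
          unfolding comm(3) by (simp add: noncomm_polynomial_ring_def koszul_sign_def)
        then have "F r \<oplus> F ?p = F ?p"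
          using F.hom_add[OF rc pq(1)] F_swap True F.hom_closed[OF pq(1)]
          by (simp add: C.koszul_sign_smult del: F.hom_add)
        then show ?thesis using C.add.r_cancel_one[OF F.hom_closed[OF pq(1)] F.hom_closed[OF rc]] by simp
      next
        case False
        then have "r = ?q \<oplus>\<^bsub>?N\<^esub> ?p"
          unfolding comm(3) by (simp add: noncomm_polynomial_ring_def koszul_sign_def)
        then have "F r = F ?q \<oplus> F ?p" using F.hom_add[OF pq(2,1)] by simp
        then show ?thesis
          using F_swap False F.hom_closed[OF pq(1)] by (simp add: C.koszul_sign_smult C.l_neg)
      qed
    next
      case square
      then have "(k, z) \<in> Sigma UNIV X" by auto
      with f have "f (k, z) \<in> homog C k" by force
      then show ?thesis
        using square F_pair[of "(k, z)" "(k, z)"] odd_square by auto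
    qed
    with rc show "r \<in> a_kernel ?N C F" unfolding a_kernel_def' by blast
  qed
  have "?I \<subseteq> a_kernel ?N C F"
    by (rule N.genideal_minimal[OF F.kernel_is_ideal relations])
  then have ker: "F x = \<zero>" if "x \<in> carrier ?N" "?I +>\<^bsub>?N\<^esub> x = \<zero>\<^bsub>comm_polynomial_ring X\<^esub>" for x
    using comm_polynomial_projection(5)[OF that(1)] that(2) by (intro F.kernel_zero) blast
  interpret Q: weakly_graded_ring "comm_polynomial_ring X" by (rule comm_polynomial_projection(2))
  obtain W where W: "W \<in> ring_hom (comm_polynomial_ring X) C"
    and W_of: "\<And>x. x \<in> carrier ?N \<Longrightarrow> W (?I +>\<^bsub>?N\<^esub> x) = F x"
    using ring_hom_factor[OF N.ring_axioms Q.ring_axioms C.ring_axioms comm_polynomial_projection(3,4)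
        graded_ring_homD(1)[OF F] ker] by blast
  have "W \<in> graded_ring_hom (comm_polynomial_ring X) C"
    unfolding graded_ring_hom_def comm_polynomial_projection(6)
    using W W_of N.homog_closed graded_ring_homD(2)[OF F] by auto
  moreover have "W (comm_variable X g) = f g" if "g \<in> Sigma UNIV X" for g
    unfolding comm_variable_def W_of[OF carrier[OF that]] by (rule F_var[OF that])
  ultimately show "\<exists>h\<in>graded_ring_hom (comm_polynomial_ring X) C. \<forall>g\<in>Sigma UNIV X. h (comm_variable X g) = f g"
    by blast
qed

section \<open>Tensor products\<close>

text \<open>The cocycle identity holds because \<open>(j, i') \<mapsto> (-1)\<^bsup>ji'\<^esup>\<close> is bimultiplicative.\<close>

lemma twisted_monoid_symbols:
  assumes "weakly_graded_ring A" "weakly_graded_ring P"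
  shows "twisted_monoid {(i, r, j, s). r \<in> homog A i \<and> s \<in> homog P j}
      (\<lambda>(i, r, j, s) (i', r', j', s'). (i + i', r \<otimes>\<^bsub>A\<^esub> r', j + j', s \<otimes>\<^bsub>P\<^esub> s'))
      (0, \<one>\<^bsub>A\<^esub>, 0, \<one>\<^bsub>P\<^esub>)
      (\<lambda>(i, r, j, s) (i', r', j', s'). koszul_sign (j * i'))
      (\<lambda>(i, r, j, s). i + j)"
proof -
  interpret A: weakly_graded_ring A by fact
  interpret P: weakly_graded_ring P by fact
  show ?thesis
    by unfold_locales
      (auto simp: A.homog_mult P.homog_mult A.homog_one P.homog_one A.homog_closed P.homog_closed
        A.m_assoc P.m_assoc koszul_sign_simps algebra_simps)
qed

lemma (in ring_hom_ring) hom_koszul: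
  assumes "x \<in> carrier R"
  shows "h ([koszul_sign n] \<cdot>\<^bsub>R\<^esub> x) = [koszul_sign n] \<cdot>\<^bsub>S\<^esub> h x"
  using assms by (simp add: R.koszul_sign_smult S.koszul_sign_smult)

lemma biadditivity_relations_carrier:
  assumes "weakly_graded_ring A" "weakly_graded_ring P"
  shows "biadditivity_relations A P \<subseteq> carrier (tensor_symbol_ring A P)"
proof
  interpret A: weakly_graded_ring A by fact
  interpret P: weakly_graded_ring P by fact
  fix x assume "x \<in> biadditivity_relations A P"
  then show "x \<in> carrier (tensor_symbol_ring A P)"
    unfolding biadditivity_relations_def tensor_symbol_ring_def twisted_monoid_ring_simps
    by (elim UnE CollectE exE conjE)
      (simp_all add: keys_diff_subset A.homog_add P.homog_add)
qed

text \<open>An isomorphism \<open>B \<cong> A \<otimes> P\<close> in the form in which it is used: a surjection \<open>\<pi>\<close> from the ring of tensor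
  symbols, which makes \<open>\<pi> (i, a, j, s)\<close> the element of \<open>B\<close> that corresponds to \<open>a \<otimes> s\<close>. Elements of
  \<open>B\<close> and maps out of \<open>B\<close> are then described by symbols, with no further mention of cosets.\<close>

locale tensor_presentation =
  A: weakly_graded_ring A + P: weakly_graded_ring P + B: weakly_graded_ring B
  for A :: "('a, 'k) graded_ring_scheme" and P :: "('p, 'l) graded_ring_scheme"
    and B :: "('b, 'm) graded_ring_scheme" +
  fixes u :: "'a \<Rightarrow> 'b" and \<pi> :: "((int \<times> 'a \<times> int \<times> 'p) \<Rightarrow>\<^sub>0 int) \<Rightarrow> 'b"
  assumes hom: "\<pi> \<in> ring_hom (tensor_symbol_ring A P) B"
    and homog_image: "\<pi> ` homog (tensor_symbol_ring A P) k = homog B k"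
    and surj: "\<pi> ` carrier (tensor_symbol_ring A P) = carrier B"
    and ker: "x \<in> carrier (tensor_symbol_ring A P) \<Longrightarrow> \<pi> x = \<zero>\<^bsub>B\<^esub> \<longleftrightarrow> x \<in> biadditivity_ideal A P"
    and unit: "a \<in> homog A i \<Longrightarrow> \<pi> (frag_of (i, a, 0, \<one>\<^bsub>P\<^esub>)) = u a"
begin

abbreviation "T \<equiv> tensor_symbol_ring A P"

sublocale T: weakly_graded_ring T
  unfolding tensor_symbol_ring_def
  by (rule twisted_monoid.weakly_graded_twisted_monoid_ring[OF twisted_monoid_symbols])
    unfold_locales

sublocale h: ring_hom_ring T B \<pi>
  by (intro ring_hom_ringI2 T.ring_axioms B.ring_axioms hom)

lemma symbol_mem: "\<lbrakk>a \<in> homog A i; s \<in> homog P j\<rbrakk> \<Longrightarrow> frag_of (i, a, j, s) \<in> homog T (i + j)"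
  by (simp add: tensor_symbol_ring_def)

lemma symbol_carrier: "\<lbrakk>a \<in> homog A i; s \<in> homog P j\<rbrakk> \<Longrightarrow> frag_of (i, a, j, s) \<in> carrier T"
  by (simp add: tensor_symbol_ring_def)

lemma relations_carrier: "biadditivity_relations A P \<subseteq> carrier T"
  by (rule biadditivity_relations_carrier[OF A.weakly_graded_ring_axioms P.weakly_graded_ring_axioms])

lemma relations_ideal: "biadditivity_relations A P \<subseteq> biadditivity_ideal A P"
  unfolding biadditivity_ideal_def by (rule T.genideal_self[OF relations_carrier])

definition tens :: "int \<Rightarrow> 'a \<Rightarrow> int \<Rightarrow> 'p \<Rightarrow> 'b" where
  "tens i a j s = \<pi> (frag_of (i, a, j, s))"

lemma tens_homog: "\<lbrakk>a \<in> homog A i; s \<in> homog P j\<rbrakk> \<Longrightarrow> tens i a j s \<in> homog B (i + j)"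
  unfolding tens_def using symbol_mem homog_image[of "i + j"] by blast

lemma tens_closed: "\<lbrakk>a \<in> homog A i; s \<in> homog P j\<rbrakk> \<Longrightarrow> tens i a j s \<in> carrier B"
  by (rule B.homog_closed[OF tens_homog])

text \<open>The products below have a middle factor of degree zero, so that the Koszul sign is trivial.\<close>

lemma tens_mult_even:
  assumes "a \<in> homog A i" "s \<in> homog P j" "a' \<in> homog A i'" "s' \<in> homog P j'" "even (j * i')"
  shows "tens i a j s \<otimes>\<^bsub>B\<^esub> tens i' a' j' s' = tens (i + i') (a \<otimes>\<^bsub>A\<^esub> a') (j + j') (s \<otimes>\<^bsub>P\<^esub> s')"
proof -
  have "frag_of (i, a, j, s) \<otimes>\<^bsub>T\<^esub> frag_of (i', a', j', s') =
      frag_of (i + i', a \<otimes>\<^bsub>A\<^esub> a', j + j', s \<otimes>\<^bsub>P\<^esub> s')"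
    using assms(5) by (simp add: tensor_symbol_ring_def koszul_sign_def)
  then show ?thesis
    unfolding tens_def using h.hom_mult[OF symbol_carrier[OF assms(1,2)] symbol_carrier[OF assms(3,4)]]
    by simp
qed

lemma tens_split:
  assumes "a \<in> homog A i" "s \<in> homog P j"
  shows "tens i a j s = u a \<otimes>\<^bsub>B\<^esub> tens 0 \<one>\<^bsub>A\<^esub> j s"
proof -
  have "u a \<otimes>\<^bsub>B\<^esub> tens 0 \<one>\<^bsub>A\<^esub> j s = tens (i + 0) (a \<otimes>\<^bsub>A\<^esub> \<one>\<^bsub>A\<^esub>) (0 + j) (\<one>\<^bsub>P\<^esub> \<otimes>\<^bsub>P\<^esub> s)"
    unfolding unit[OF assms(1), symmetric] tens_def[symmetric]
    by (rule tens_mult_even) (simp_all add: assms A.homog_one P.homog_one)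
  then show ?thesis using assms by (simp add: A.homog_closed P.homog_closed)
qed

lemma tens_one: "tens 0 \<one>\<^bsub>A\<^esub> 0 \<one>\<^bsub>P\<^esub> = \<one>\<^bsub>B\<^esub>"
  using h.hom_one unfolding tens_def by (simp add: tensor_symbol_ring_def)

lemma tens_add:
  assumes "a \<in> homog A i" "s \<in> homog P j" "s' \<in> homog P j"
  shows "tens i a j (s \<oplus>\<^bsub>P\<^esub> s') = tens i a j s \<oplus>\<^bsub>B\<^esub> tens i a j s'"
proof -
  let ?x = "frag_of (i, a, j, s)" and ?y = "frag_of (i, a, j, s')"
    and ?z = "frag_of (i, a, j, s \<oplus>\<^bsub>P\<^esub> s')"
  have xyz: "?x \<in> carrier T" "?y \<in> carrier T" "?z \<in> carrier T"
    by (intro symbol_carrier P.homog_add assms)+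
  have r: "?z - ?x - ?y \<in> biadditivity_relations A P"
    unfolding biadditivity_relations_def using assms by blast
  then have rc: "?z - ?x - ?y \<in> carrier T" using relations_carrier by blast
  then have "\<pi> (?z - ?x - ?y) = \<zero>\<^bsub>B\<^esub>" using ker r relations_ideal by blast
  moreover have "?z = (?z - ?x - ?y) \<oplus>\<^bsub>T\<^esub> (?x \<oplus>\<^bsub>T\<^esub> ?y)" by (simp add: tensor_symbol_ring_def)
  then have "\<pi> ?z = \<pi> (?z - ?x - ?y) \<oplus>\<^bsub>B\<^esub> (\<pi> ?x \<oplus>\<^bsub>B\<^esub> \<pi> ?y)"
    using h.hom_add rc xyz T.a_closed by metis
  ultimately show ?thesis
    unfolding tens_def using xyz h.hom_closed B.a_closed B.l_zero by metis
qed

lemma tens_zero: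
  assumes "a \<in> homog A i"
  shows "tens i a j \<zero>\<^bsub>P\<^esub> = \<zero>\<^bsub>B\<^esub>"
proof -
  have c: "tens i a j \<zero>\<^bsub>P\<^esub> \<in> carrier B" by (rule tens_closed[OF assms P.homog_zero])
  have "tens i a j \<zero>\<^bsub>P\<^esub> = tens i a j \<zero>\<^bsub>P\<^esub> \<oplus>\<^bsub>B\<^esub> tens i a j \<zero>\<^bsub>P\<^esub>"
    using tens_add[OF assms P.homog_zero P.homog_zero] by simp
  then show ?thesis using B.add.r_cancel_one[OF c c] by simp
qed

lemma tens_diff:
  assumes "a \<in> homog A i" "s \<in> homog P j" "s' \<in> homog P j"
  shows "tens i a j (s \<ominus>\<^bsub>P\<^esub> s') = tens i a j s \<ominus>\<^bsub>B\<^esub> tens i a j s'"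
proof -
  have c: "s \<in> carrier P" "s' \<in> carrier P" using assms P.homog_closed by blast+
  have d: "s \<ominus>\<^bsub>P\<^esub> s' \<in> homog P j" by (rule P.homog_diff[OF assms(2,3)])
  have "s \<ominus>\<^bsub>P\<^esub> s' \<oplus>\<^bsub>P\<^esub> s' = s" using c by (simp add: P.minus_eq P.a_assoc P.l_neg)
  then have "tens i a j s = tens i a j (s \<ominus>\<^bsub>P\<^esub> s') \<oplus>\<^bsub>B\<^esub> tens i a j s'"
    using tens_add[OF assms(1) d assms(3)] by simp
  then show ?thesis
    using tens_closed[OF assms(1) d] tens_closed[OF assms(1,3)]
    by (simp add: B.minus_eq B.a_assoc B.r_neg)
qed

definition lift :: "(int \<times> 'x \<Rightarrow> 'p) \<Rightarrow> int \<times> 'x \<Rightarrow> 'b" where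
  "lift y g = tens 0 \<one>\<^bsub>A\<^esub> (fst g) (y g)"

lemma lift_homog: "y g \<in> homog P (fst g) \<Longrightarrow> lift y g \<in> homog B (fst g)"
  unfolding lift_def using tens_homog[OF A.homog_one, of "y g" "fst g"] by simp

lemma tens_word:
  assumes "w \<in> lists G" and y: "\<And>g. g \<in> G \<Longrightarrow> y g \<in> homog P (fst g)"
  shows "tens 0 \<one>\<^bsub>A\<^esub> (word_degree w) (word_value P y w) = word_value B (lift y) w"
  using assms(1)
proof (induction w)
  case Nil
  then show ?case by (simp add: tens_one)
next
  case (Cons g w)
  have "lift y g \<otimes>\<^bsub>B\<^esub> word_value B (lift y) w =
      lift y g \<otimes>\<^bsub>B\<^esub> tens 0 \<one>\<^bsub>A\<^esub> (word_degree w) (word_value P y w)"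
    using Cons by simp
  also have "\<dots> = tens (0 + 0) (\<one>\<^bsub>A\<^esub> \<otimes>\<^bsub>A\<^esub> \<one>\<^bsub>A\<^esub>) (fst g + word_degree w) (y g \<otimes>\<^bsub>P\<^esub> word_value P y w)"
    unfolding lift_def
    by (rule tens_mult_even) (use Cons in \<open>simp_all add: A.homog_one y P.word_value_homog[OF _ y]\<close>)
  finally show ?case by simp
qed

text \<open>Every \<open>a \<otimes> s\<close> is the product of \<open>a \<otimes> 1\<close> and \<open>1 \<otimes> s\<close>. It is additive in \<open>s\<close>, and \<open>s\<close> is an additive
  combination of words in the generators.\<close>

theorem monomials_span:
  assumes gen: "word_generated P G y"
  shows "homog B k \<subseteq> generate (add_monoid B)
    {u a \<otimes>\<^bsub>B\<^esub> word_value B (lift y) w | i a w. a \<in> homog A i \<and> w \<in> lists G \<and> i + word_degree w = k}"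
    (is "_ \<subseteq> ?H")
proof
  have y: "\<And>g. g \<in> G \<Longrightarrow> y g \<in> homog P (fst g)" using gen by (simp add: word_generated_def)
  have uc: "u a \<in> carrier B" if "a \<in> homog A i" for a i
    unfolding unit[OF that, symmetric] by (rule h.hom_closed[OF symbol_carrier[OF that P.homog_one]])
  have zc: "\<And>g. g \<in> G \<Longrightarrow> lift y g \<in> carrier B" by (rule B.homog_closed[OF lift_homog[OF y]])
  interpret H: additive_subgroup ?H B
    by (rule B.additive_span_subgroup)
      (auto intro!: B.m_closed uc B.word_value_closed[where G = G] zc)
  have mem: "tens i a j s \<in> ?H" if a: "a \<in> homog A i" and s: "s \<in> homog P j" and k: "i + j = k" for i a j s
  proof -
    have "s \<in> generate (add_monoid P) {word_value P y w | w. w \<in> lists G \<and> word_degree w = j}"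
      using gen s unfolding word_generated_def by blast
    moreover have "{word_value P y w |w. w \<in> lists G \<and> word_degree w = j} \<subseteq> carrier P"
      by (auto intro!: P.word_value_closed[where G = G] P.homog_closed[OF y])
    ultimately have "s \<in> homog P j \<and> tens i a j s \<in> ?H"
    proof (induction rule: P.additive_span_induct)
      case zero
      show ?case using P.homog_zero tens_zero[OF a] H.zero_closed by simp
    next
      case (generator s)
      then obtain w where w: "w \<in> lists G" "word_degree w = j" "s = word_value P y w" by blast
      have s: "s \<in> homog P j" using P.word_value_homog[OF w(1) y] w by simp
      have "tens i a j s = u a \<otimes>\<^bsub>B\<^esub> word_value B (lift y) w"
        using tens_split[OF a s] tens_word[OF w(1) y] w by simp
      then show ?case using s a w k by (blast intro: generate.incl)
    next
      case (diff s s')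
      then show ?case
        using P.homog_diff[of s j s'] tens_diff[OF a, of s j s'] H.diff_closed by simp
    qed
    then show ?thesis ..
  qed
  fix b assume "b \<in> homog B k"
  then obtain f where f: "f \<in> homog T k" "b = \<pi> f" using homog_image by blast
  interpret S: twisted_monoid "{(i, r, j, s). r \<in> homog A i \<and> s \<in> homog P j}"
      "\<lambda>(i, r, j, s) (i', r', j', s'). (i + i', r \<otimes>\<^bsub>A\<^esub> r', j + j', s \<otimes>\<^bsub>P\<^esub> s')"
      "(0, \<one>\<^bsub>A\<^esub>, 0, \<one>\<^bsub>P\<^esub>)"
      "\<lambda>(i, r, j, s) (i', r', j', s'). koszul_sign (j * i')"
      "\<lambda>(i, r, j, s). i + j"
    by (rule twisted_monoid_symbols[OF A.weakly_graded_ring_axioms P.weakly_graded_ring_axioms])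
  note T_def = tensor_symbol_ring_def[symmetric, of A P]
  have "\<pi> f \<in> ?H"
    using f(1)
  proof (induction rule: S.homog_induct[unfolded T_def, consumes 1, case_names zero basis diff])
    case zero
    have "\<pi> \<zero>\<^bsub>T\<^esub> \<in> ?H" using h.hom_zero H.zero_closed by simp
    then show ?case by (simp add: tensor_symbol_ring_def)
  next
    case (basis s)
    then show ?case using mem unfolding tens_def by force
  next
    case (diff f g)
    have "f \<in> carrier T" "g \<in> carrier T" using diff T.homog_closed by blast+
    then have "\<pi> (f - g) = \<pi> f \<ominus>\<^bsub>B\<^esub> \<pi> g"
      using S.twisted_diff[unfolded T_def, of f g] h.hom_diff[of f g] by simp
    then show ?case using H.diff_closed diff by simp
  qed
  then show "b \<in> ?H" using f by simp
qed

text \<open>The map is \<open>a \<otimes> s \<mapsto> t a \<cdot> E s\<close>, where \<open>E\<close> extends \<open>f\<close> to \<open>P\<close>. It respects the Koszul product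
  exactly because the image of \<open>t\<close> is central in the graded sense: moving \<open>E s\<close> past \<open>t r'\<close>
  produces the sign of the tensor product.\<close>

theorem graded_hom_extension:
  fixes C :: "('c, 'n) graded_ring_scheme"
  assumes "weakly_graded_ring C" and free: "free_for P G y C"
    and y: "\<And>g. g \<in> G \<Longrightarrow> y g \<in> homog P (fst g)"
    and t: "t \<in> graded_ring_hom A C"
    and central: "\<And>a c i j. \<lbrakk>a \<in> homog A i; c \<in> homog C j\<rbrakk> \<Longrightarrow>
      t a \<otimes>\<^bsub>C\<^esub> c = [koszul_sign (i * j)] \<cdot>\<^bsub>C\<^esub> (c \<otimes>\<^bsub>C\<^esub> t a)"
    and f: "\<And>g. g \<in> G \<Longrightarrow> f g \<in> homog C (fst g)"
  shows "\<exists>W\<in>graded_ring_hom B C.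
    (\<forall>i. \<forall>a\<in>homog A i. W (u a) = t a) \<and> (\<forall>g\<in>G. W (lift y g) = f g)"
proof -
  interpret C: weakly_graded_ring C by fact
  obtain E where E: "E \<in> graded_ring_hom P C" and E_gen: "\<And>g. g \<in> G \<Longrightarrow> E (y g) = f g"
    using free f unfolding free_for_def by blast
  interpret t: ring_hom_ring A C t
    by (intro ring_hom_ringI2 A.ring_axioms C.ring_axioms graded_ring_homD(1)[OF t])
  interpret E: ring_hom_ring P C E
    by (intro ring_hom_ringI2 P.ring_axioms C.ring_axioms graded_ring_homD(1)[OF E])
  note t_homog = graded_ring_homD(2)[OF t] and E_homog = graded_ring_homD(2)[OF E]
  interpret S: twisted_monoid "{(i, r, j, s). r \<in> homog A i \<and> s \<in> homog P j}"
      "\<lambda>(i, r, j, s) (i', r', j', s'). (i + i', r \<otimes>\<^bsub>A\<^esub> r', j + j', s \<otimes>\<^bsub>P\<^esub> s')"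
      "(0, \<one>\<^bsub>A\<^esub>, 0, \<one>\<^bsub>P\<^esub>)"
      "\<lambda>(i, r, j, s) (i', r', j', s'). koszul_sign (j * i')"
      "\<lambda>(i, r, j, s). i + j"
    by (rule twisted_monoid_symbols[OF A.weakly_graded_ring_axioms P.weakly_graded_ring_axioms])
  note T_def = tensor_symbol_ring_def[symmetric, of A P]
  have mult: "t r \<otimes>\<^bsub>C\<^esub> E s \<otimes>\<^bsub>C\<^esub> (t r' \<otimes>\<^bsub>C\<^esub> E s') =
      [koszul_sign (j * i')] \<cdot>\<^bsub>C\<^esub> (t (r \<otimes>\<^bsub>A\<^esub> r') \<otimes>\<^bsub>C\<^esub> E (s \<otimes>\<^bsub>P\<^esub> s'))"
    if "r \<in> homog A i" "s \<in> homog P j" "r' \<in> homog A i'" "s' \<in> homog P j'" for i r j s i' r' j' s'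
  proof -
    have rc: "r \<in> carrier A" "r' \<in> carrier A" "s \<in> carrier P" "s' \<in> carrier P"
      using that A.homog_closed P.homog_closed by blast+
    have c: "t r \<in> carrier C" "t r' \<in> carrier C" "E s \<in> carrier C" "E s' \<in> carrier C"
      using rc by simp_all
    have "t r' \<otimes>\<^bsub>C\<^esub> E s = [koszul_sign (i' * j)] \<cdot>\<^bsub>C\<^esub> (E s \<otimes>\<^bsub>C\<^esub> t r')"
      by (rule central[OF that(3) E_homog[OF that(2)]])
    then have "E s \<otimes>\<^bsub>C\<^esub> t r' = [koszul_sign (j * i')] \<cdot>\<^bsub>C\<^esub> (t r' \<otimes>\<^bsub>C\<^esub> E s)"
      using c by (auto simp: C.koszul_sign_smult mult.commute)
    moreover have "t r \<otimes>\<^bsub>C\<^esub> E s \<otimes>\<^bsub>C\<^esub> (t r' \<otimes>\<^bsub>C\<^esub> E s') =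
        t r \<otimes>\<^bsub>C\<^esub> (E s \<otimes>\<^bsub>C\<^esub> t r') \<otimes>\<^bsub>C\<^esub> E s'"
      using c by (simp add: C.m_assoc)
    moreover have "t r \<otimes>\<^bsub>C\<^esub> (t r' \<otimes>\<^bsub>C\<^esub> E s) \<otimes>\<^bsub>C\<^esub> E s' =
        t (r \<otimes>\<^bsub>A\<^esub> r') \<otimes>\<^bsub>C\<^esub> E (s \<otimes>\<^bsub>P\<^esub> s')"
      using c rc by (simp add: C.m_assoc)
    ultimately show ?thesis
      using c rc by (simp add: C.koszul_sign_smult C.r_minus C.l_minus)
  qed
  obtain F where F: "F \<in> ring_hom T C"
    and F_of: "\<And>i r j s. \<lbrakk>r \<in> homog A i; s \<in> homog P j\<rbrakk> \<Longrightarrow> F (frag_of (i, r, j, s)) = t r \<otimes>\<^bsub>C\<^esub> E s"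
  proof (rule S.twisted_monoid_ring_universal[OF C.ring_axioms, of "\<lambda>(i, r, j, s). t r \<otimes>\<^bsub>C\<^esub> E s", unfolded T_def])
    fix x assume "x \<in> {(i, r, j, s). r \<in> homog A i \<and> s \<in> homog P j}"
    then show "(case x of (i, r, j, s) \<Rightarrow> t r \<otimes>\<^bsub>C\<^esub> E s) \<in> carrier C"
      using A.homog_closed P.homog_closed by auto
  next
    fix x x' assume "x \<in> {(i, r, j, s). r \<in> homog A i \<and> s \<in> homog P j}"
      "x' \<in> {(i, r, j, s). r \<in> homog A i \<and> s \<in> homog P j}"
    then show "(case x of (i, r, j, s) \<Rightarrow> t r \<otimes>\<^bsub>C\<^esub> E s) \<otimes>\<^bsub>C\<^esub> (case x' of (i, r, j, s) \<Rightarrow> t r \<otimes>\<^bsub>C\<^esub> E s) =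
        [(case x of (i, r, j, s) \<Rightarrow> \<lambda>(i', r', j', s'). koszul_sign (j * i')) x'] \<cdot>\<^bsub>C\<^esub>
        (case (case x of (i, r, j, s) \<Rightarrow> \<lambda>(i', r', j', s'). (i + i', r \<otimes>\<^bsub>A\<^esub> r', j + j', s \<otimes>\<^bsub>P\<^esub> s')) x' of
          (i, r, j, s) \<Rightarrow> t r \<otimes>\<^bsub>C\<^esub> E s)"
      using mult by (auto split: prod.splits)
  qed (use that in auto)
  interpret F: ring_hom_ring T C F
    by (intro ring_hom_ringI2 T.ring_axioms C.ring_axioms F)
  have F_graded: "F \<in> graded_ring_hom T C"
    by (rule S.graded_hom_on_basis[OF C.weakly_graded_ring_axioms, unfolded T_def, OF F])
      (auto simp: F_of intro!: C.homog_mult t_homog E_homog)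
  have relations: "biadditivity_relations A P \<subseteq> a_kernel T C F"
  proof
    fix x assume x: "x \<in> biadditivity_relations A P"
    then have xc: "x \<in> carrier T" using relations_carrier by blast
    obtain p q q' where pq: "p \<in> carrier T" "q \<in> carrier T" "q' \<in> carrier T" and x: "x = p - q - q'"
      and F_pq: "F p = F q \<oplus>\<^bsub>C\<^esub> F q'"
      using x unfolding biadditivity_relations_def
    proof (elim UnE CollectE exE conjE)
      fix i r r' j s
      assume *: "x = frag_of (i, r \<oplus>\<^bsub>A\<^esub> r', j, s) - frag_of (i, r, j, s) - frag_of (i, r', j, s)"
        "r \<in> homog A i" "r' \<in> homog A i" "s \<in> homog P j"
      then have "r \<in> carrier A" "r' \<in> carrier A" "s \<in> carrier P"
        using A.homog_closed P.homog_closed by blast+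
      then show thesis
        using * by (intro that[OF _ _ _ *(1)] symbol_carrier)
          (simp_all add: F_of A.homog_add C.l_distr)
    next
      fix i r j s s'
      assume *: "x = frag_of (i, r, j, s \<oplus>\<^bsub>P\<^esub> s') - frag_of (i, r, j, s) - frag_of (i, r, j, s')"
        "r \<in> homog A i" "s \<in> homog P j" "s' \<in> homog P j"
      then have "r \<in> carrier A" "s \<in> carrier P" "s' \<in> carrier P"
        using A.homog_closed P.homog_closed by blast+
      then show thesis
        using * by (intro that[OF _ _ _ *(1)] symbol_carrier)
          (simp_all add: F_of P.homog_add C.r_distr)
    qed
    have "p = x \<oplus>\<^bsub>T\<^esub> (q \<oplus>\<^bsub>T\<^esub> q')" unfolding x by (simp add: tensor_symbol_ring_def)
    then have "F p = F x \<oplus>\<^bsub>C\<^esub> (F q \<oplus>\<^bsub>C\<^esub> F q')"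
      using F.hom_add xc pq T.a_closed by metis
    then have "F x = \<zero>\<^bsub>C\<^esub>"
      using C.add.r_cancel_one[of "F q \<oplus>\<^bsub>C\<^esub> F q'" "F x"] F_pq xc pq by simp
    with xc show "x \<in> a_kernel T C F" unfolding a_kernel_def' by blast
  qed
  have "biadditivity_ideal A P \<subseteq> a_kernel T C F"
    unfolding biadditivity_ideal_def by (rule T.genideal_minimal[OF F.kernel_is_ideal relations])
  then have F_ker: "F x = \<zero>\<^bsub>C\<^esub>" if "x \<in> carrier T" "\<pi> x = \<zero>\<^bsub>B\<^esub>" for x
    using ker[OF that(1)] that(2) by (intro F.kernel_zero) blast
  obtain W where W: "W \<in> ring_hom B C" and W_of: "\<And>x. x \<in> carrier T \<Longrightarrow> W (\<pi> x) = F x"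
    using ring_hom_factor[OF T.ring_axioms B.ring_axioms C.ring_axioms hom surj F F_ker] by blast
  have "W \<in> graded_ring_hom B C"
    unfolding graded_ring_hom_def homog_image[symmetric]
    using W W_of T.homog_closed graded_ring_homD(2)[OF F_graded] by auto
  moreover have "W (u a) = t a" if a: "a \<in> homog A i" for a i
    unfolding unit[OF a, symmetric] W_of[OF symbol_carrier[OF a P.homog_one]]
    using F_of[OF a P.homog_one] A.homog_closed[OF a] by simp
  moreover have "W (lift y g) = f g" if g: "g \<in> G" for g
    unfolding lift_def tens_def W_of[OF symbol_carrier[OF A.homog_one y[OF g]]]
    using F_of[OF A.homog_one y[OF g]] E_gen[OF g] C.homog_closed[OF f[OF g]] by simp
  ultimately show ?thesis by blast
qed

end

lemma tensor_presentation_of_iso: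
  assumes "weakly_graded_ring A" "weakly_graded_ring P" "weakly_graded_ring B"
    and \<phi>: "\<phi> \<in> graded_tensor_iso A B u P"
    and u: "\<And>a i. a \<in> homog A i \<Longrightarrow> u a \<in> carrier B"
  obtains \<pi> where "tensor_presentation A P B u \<pi>"
proof -
  interpret A: weakly_graded_ring A by fact
  interpret P: weakly_graded_ring P by fact
  interpret B: weakly_graded_ring B by fact
  let ?S = "tensor_symbol_ring A P" and ?T = "graded_tensor A P"
  let ?I = "biadditivity_ideal A P"
  interpret S: weakly_graded_ring ?S
    unfolding tensor_symbol_ring_def
    by (rule twisted_monoid.weakly_graded_twisted_monoid_ring[OF twisted_monoid_symbols[OF assms(1,2)]])
  have ideal: "ideal ?I ?S"
    unfolding biadditivity_ideal_def
    by (rule S.genideal_ideal[OF biadditivity_relations_carrier[OF assms(1,2)]])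
  note proj = graded_quotient_projection[OF S.weakly_graded_ring_axioms ideal, folded graded_tensor_def]
  have iso: "\<phi> \<in> ring_iso B ?T" and homog_\<phi>: "\<And>i. \<phi> ` homog B i = homog ?T i"
    and unit_\<phi>: "\<And>i a. a \<in> homog A i \<Longrightarrow> \<phi> (u a) = pure_tensor A P i a 0 \<one>\<^bsub>P\<^esub>"
    using \<phi> by (auto simp: graded_tensor_iso_def)
  have bij: "bij_betw \<phi> (carrier B) (carrier ?T)" using iso by (simp add: ring_iso_def)
  define \<psi> where "\<psi> = inv_into (carrier B) \<phi>"
  have \<psi>: "\<psi> \<in> ring_iso ?T B" unfolding \<psi>_def by (rule ring_iso_set_sym[OF B.ring_axioms iso])
  then have \<psi>_hom: "\<psi> \<in> ring_hom ?T B" and \<psi>_bij: "bij_betw \<psi> (carrier ?T) (carrier B)"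
    by (simp_all add: ring_iso_def)
  have \<psi>_\<phi>: "\<psi> (\<phi> b) = b" if "b \<in> carrier B" for b
    unfolding \<psi>_def using bij that by (simp add: bij_betw_inv_into_left)
  interpret T: weakly_graded_ring ?T by (rule proj(1))
  interpret \<psi>: ring_hom_ring ?T B \<psi> by (intro ring_hom_ringI2 T.ring_axioms B.ring_axioms \<psi>_hom)
  let ?\<pi> = "\<psi> \<circ> (+>\<^bsub>?S\<^esub>) ?I"
  have "tensor_presentation A P B u ?\<pi>"
  proof (intro tensor_presentation.intro tensor_presentation_axioms.intro assms(1-3))
    show "?\<pi> \<in> ring_hom ?S B" by (rule ring_hom_trans[OF proj(2) \<psi>_hom])
    show "?\<pi> ` homog ?S k = homog B k" for k
    proof -
      have "?\<pi> ` homog ?S k = \<psi> ` homog ?T k"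
        by (simp add: image_comp graded_tensor_def graded_quotient_simps(6))
      also have "\<dots> = (\<lambda>b. \<psi> (\<phi> b)) ` homog B k"
        unfolding homog_\<phi>[symmetric] image_image ..
      also have "\<dots> = homog B k" using \<psi>_\<phi> B.homog_closed by force
      finally show ?thesis .
    qed
    show "?\<pi> ` carrier ?S = carrier B"
      unfolding image_comp[symmetric] proj(3) using \<psi>_bij by (simp add: bij_betw_def)
  next
    fix x assume x: "x \<in> carrier ?S"
    have c: "?I +>\<^bsub>?S\<^esub> x \<in> carrier ?T" using proj(3) x by blast
    have "\<psi> (?I +>\<^bsub>?S\<^esub> x) = \<zero>\<^bsub>B\<^esub> \<longleftrightarrow> \<psi> (?I +>\<^bsub>?S\<^esub> x) = \<psi> \<zero>\<^bsub>?T\<^esub>" by simp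
    also have "\<dots> \<longleftrightarrow> ?I +>\<^bsub>?S\<^esub> x = \<zero>\<^bsub>?T\<^esub>"
      by (rule inj_on_eq_iff[OF bij_betw_imp_inj_on[OF \<psi>_bij] c T.zero_closed])
    also have "\<dots> \<longleftrightarrow> x \<in> ?I" by (rule proj(4)[OF x])
    finally show "?\<pi> x = \<zero>\<^bsub>B\<^esub> \<longleftrightarrow> x \<in> ?I" by simp
  next
    fix a i assume a: "a \<in> homog A i"
    have "?\<pi> (frag_of (i, a, 0, \<one>\<^bsub>P\<^esub>)) = \<psi> (\<phi> (u a))"
      by (simp add: unit_\<phi>[OF a] pure_tensor_def)
    then show "?\<pi> (frag_of (i, a, 0, \<one>\<^bsub>P\<^esub>)) = u a" using \<psi>_\<phi>[OF u[OF a]] by simp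
  qed
  then show thesis by (rule that)
qed

section \<open>Homogeneous components and differentials\<close>

context graded_ring
begin

sublocale weak: weakly_graded_ring R
  by (rule weakly_graded)

lemma graded_induct [consumes 1, case_names homog add]:
  assumes "x \<in> carrier R"
    and homog: "\<And>i a. a \<in> homog R i \<Longrightarrow> Q a"
    and add: "\<And>a b. \<lbrakk>a \<in> carrier R; b \<in> carrier R; Q a; Q b\<rbrakk> \<Longrightarrow> Q (a \<oplus> b)"
  shows "Q x"
proof -
  obtain c where c: "\<And>i. c i \<in> homog R i" and fin: "finite {i. c i \<noteq> \<zero>}"
    and x: "x = (\<Oplus>i\<in>{i. c i \<noteq> \<zero>}. c i)"
    using homog_decomposition[OF assms(1)] by blast
  have cc: "c i \<in> carrier R" for i by (rule weak.homog_closed[OF c])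
  have "Q (\<Oplus>i\<in>I. c i)" if "finite I" for I
    using that
  proof (induction I rule: finite_induct)
    case empty
    then show ?case using homog[OF weak.homog_zero] by simp
  next
    case (insert i I)
    then have "(\<Oplus>i\<in>insert i I. c i) = c i \<oplus> (\<Oplus>i\<in>I. c i)" using cc by (simp add: Pi_def)
    then show ?case using insert add[of "c i" "\<Oplus>i\<in>I. c i"] homog[OF c] cc by (simp add: Pi_def)
  qed
  then show ?thesis using fin x by simp
qed

text \<open>Uniqueness of the decomposition, applied to the given sum and to its value as a single term.\<close>

lemma homogeneous_component:
  assumes "finite I" and c: "\<And>i. i \<in> I \<Longrightarrow> c i \<in> homog R i" and x: "(\<Oplus>i\<in>I. c i) \<in> homog R k"
  shows "(\<Oplus>i\<in>I. c i) = (if k \<in> I then c k else \<zero>)"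
proof -
  let ?x = "\<Oplus>i\<in>I. c i"
  \<comment> \<open>The given sum and the single term in degree \<open>k\<close>, both extended by zero to all degrees.\<close>
  define c1 where "c1 i = (if i \<in> I then c i else \<zero>)" for i
  define c2 where "c2 i = (if i = k then ?x else \<zero>)" for i
  have cc: "c i \<in> carrier R" if "i \<in> I" for i by (rule weak.homog_closed[OF c[OF that]])
  have xc: "?x \<in> carrier R" by (rule weak.homog_closed[OF x])
  have sub: "{i. c1 i \<noteq> \<zero>} \<subseteq> I" by (auto simp: c1_def)
  have "(\<Oplus>i\<in>{i. c1 i \<noteq> \<zero>}. c1 i) = ?x"
    by (rule add.finprod_mono_neutral_cong_left[OF assms(1) sub]) (auto simp: c1_def cc Pi_def)
  then have d1: "(\<forall>i. c1 i \<in> homog R i) \<and> finite {i. c1 i \<noteq> \<zero>} \<and> ?x = (\<Oplus>i\<in>{i. c1 i \<noteq> \<zero>}. c1 i)"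
    using c weak.homog_zero finite_subset[OF sub assms(1)] by (simp add: c1_def)
  have sub2: "{i. c2 i \<noteq> \<zero>} \<subseteq> {k}" by (auto simp: c2_def)
  have "(\<Oplus>i\<in>{i. c2 i \<noteq> \<zero>}. c2 i) = (\<Oplus>i\<in>{k}. c2 i)"
    by (rule add.finprod_mono_neutral_cong_left[OF _ sub2]) (auto simp: c2_def xc)
  also have "\<dots> = ?x" using xc by (simp add: c2_def)
  finally have d2: "(\<forall>i. c2 i \<in> homog R i) \<and> finite {i. c2 i \<noteq> \<zero>} \<and> ?x = (\<Oplus>i\<in>{i. c2 i \<noteq> \<zero>}. c2 i)"
    using x weak.homog_zero finite_subset[OF sub2] by (simp add: c2_def)
  have "c1 = c2" using homog_decomposition[OF xc] d1 d2 by blast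
  then have "c1 k = c2 k" by simp
  then show ?thesis by (simp add: c1_def c2_def)
qed

text \<open>Elements of the center are sums of homogeneous central elements. A homogeneous element of the
  center is zero or one of these summands, so it satisfies the commutation rule itself.\<close>

lemma graded_center_commute:
  assumes "x \<in> graded_center R" "x \<in> homog R i" "c \<in> homog R j"
  shows "x \<otimes> c = [koszul_sign (i * j)] \<cdot> (c \<otimes> x)"
proof -
  obtain I b where fin: "finite I" and b: "\<And>i. i \<in> I \<Longrightarrow> b i \<in> homog R i"
    and comm: "\<And>i j c. \<lbrakk>i \<in> I; c \<in> homog R j\<rbrakk> \<Longrightarrow> b i \<otimes> c = [koszul_sign (i * j)] \<cdot> (c \<otimes> b i)"
    and x: "x = (\<Oplus>i\<in>I. b i)"
    using assms(1) unfolding graded_center_def by blast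
  have "x = (if i \<in> I then b i else \<zero>)"
    unfolding x by (rule homogeneous_component[OF fin b]) (use assms(2) x in auto)
  then show ?thesis
    using comm[of i c j] assms(3) weak.homog_closed[of c j]
    by (cases "i \<in> I") (simp_all add: koszul_sign_smult)
qed

end

text \<open>Any preimage of \<open>s\<close> has a component of degree \<open>k\<close>, and this component already maps to \<open>s\<close>.\<close>

lemma graded_surjective:
  assumes "graded_ring R" "graded_ring S" and h: "h \<in> graded_ring_hom R S"
    and surj: "h ` carrier R = carrier S" and s: "s \<in> homog S k"
  obtains r where "r \<in> homog R k" "h r = s"
proof -
  interpret R: graded_ring R by fact
  interpret S: graded_ring S by fact
  interpret h: ring_hom_ring R S h
    by (intro ring_hom_ringI2 R.ring_axioms S.ring_axioms graded_ring_homD(1)[OF h])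
  obtain x where x: "x \<in> carrier R" "s = h x" using surj S.weak.homog_closed[OF s] by (metis imageE)
  obtain c where c: "\<And>i. c i \<in> homog R i" and fin: "finite {i. c i \<noteq> \<zero>\<^bsub>R\<^esub>}"
    and xc: "x = (\<Oplus>\<^bsub>R\<^esub>i\<in>{i. c i \<noteq> \<zero>\<^bsub>R\<^esub>}. c i)"
    using R.homog_decomposition[OF x(1)] by blast
  let ?I = "{i. c i \<noteq> \<zero>\<^bsub>R\<^esub>}"
  have cc: "c i \<in> carrier R" for i by (rule R.weak.homog_closed[OF c])
  have "h (\<Oplus>\<^bsub>R\<^esub>i\<in>I. c i) = (\<Oplus>\<^bsub>S\<^esub>i\<in>I. h (c i))" if "finite I" for I
    using that by (induction I rule: finite_induct) (simp_all add: cc Pi_def)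
  then have s_sum: "s = (\<Oplus>\<^bsub>S\<^esub>i\<in>?I. h (c i))" using fin x(2) xc by simp
  have "(\<Oplus>\<^bsub>S\<^esub>i\<in>?I. h (c i)) = (if k \<in> ?I then h (c k) else \<zero>\<^bsub>S\<^esub>)"
    by (rule S.homogeneous_component[OF fin graded_ring_homD(2)[OF h c]]) (use s s_sum in simp)
  then have "h (c k) = s" unfolding s_sum by (cases "c k = \<zero>\<^bsub>R\<^esub>") simp_all
  with c that show thesis by blast
qed

context dg_ring
begin

lemma differential_closed: "a \<in> carrier A \<Longrightarrow> differential A a \<in> carrier A"
proof (induction rule: graded_induct)
  case (homog i a)
  show ?case by (rule weak.homog_closed[OF differential_degree[OF homog]])
qed (simp add: differential_add)

lemma differential_zero: "differential A \<zero> = \<zero>"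
proof -
  have c: "differential A \<zero> \<in> carrier A" by (simp add: differential_closed)
  have "differential A \<zero> = differential A \<zero> \<oplus> differential A \<zero>"
    using differential_add[of \<zero> \<zero>] by simp
  then show ?thesis using add.r_cancel_one[OF c c] by simp
qed

lemma differential_diff:
  assumes "a \<in> carrier A" "b \<in> carrier A"
  shows "differential A (a \<ominus> b) = differential A a \<ominus> differential A b"
proof -
  have c: "differential A (a \<ominus> b) \<in> carrier A" "differential A b \<in> carrier A"
    using assms by (simp_all add: differential_closed)
  have "a = (a \<ominus> b) \<oplus> b" using assms by (simp add: minus_eq a_assoc l_neg)
  then have "differential A a = differential A (a \<ominus> b) \<oplus> differential A b"
    using differential_add[of "a \<ominus> b" b] assms by simp
  then show ?thesis using c by (simp add: minus_eq a_assoc r_neg)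
qed

end

section \<open>Cohomology and surjective quasi-isomorphisms\<close>

context dg_ring
begin

lemma coboundaries_subgroup: "additive_subgroup (coboundaries A i) A"
proof (rule additive_subgroup_diffI)
  show "coboundaries A i \<subseteq> carrier A"
    unfolding coboundaries_def using weak.homog_closed differential_closed by blast
  show "\<zero> \<in> coboundaries A i"
    unfolding coboundaries_def using differential_zero weak.homog_zero by (metis image_eqI)
  fix x y assume "x \<in> coboundaries A i" "y \<in> coboundaries A i"
  then obtain a b where ab: "a \<in> homog A (i - 1)" "b \<in> homog A (i - 1)"
    "x = differential A a" "y = differential A b"
    unfolding coboundaries_def by blast
  then have "x \<ominus> y = differential A (a \<ominus> b)"
    by (simp add: differential_diff weak.homog_closed)
  then show "x \<ominus> y \<in> coboundaries A i"
    unfolding coboundaries_def using weak.homog_diff[OF ab(1,2)] by blast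
qed

lemma cocycle_carrier: "z \<in> cocycles A i \<Longrightarrow> z \<in> carrier A"
  unfolding cocycles_def using weak.homog_closed by blast

lemma cohomology_carrier: "carrier (cohomology A i) = (\<lambda>z. coboundaries A i +> z) ` cocycles A i"
  unfolding cohomology_def FactGroup_def RCOSETS_def a_r_coset_def r_coset_def by auto

end

lemma dg_ring_hom_graded:
  assumes "f \<in> dg_ring_hom A B"
  shows "f \<in> graded_ring_hom A B" "f \<in> ring_hom A B"
    and "a \<in> homog A i \<Longrightarrow> f a \<in> homog B i"
    and "a \<in> carrier A \<Longrightarrow> f (differential A a) = differential B (f a)"
  using assms by (auto simp: dg_ring_hom_def graded_ring_hom_def)

text \<open>The image of a class is defined as a union over its representatives; all of them give the same
  coset.\<close>

lemma cohomology_map_class: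
  assumes "dg_ring A" "dg_ring B" and f: "f \<in> dg_ring_hom A B" and z: "z \<in> cocycles A i"
  shows "cohomology_map B f i (coboundaries A i +>\<^bsub>A\<^esub> z) = coboundaries B i +>\<^bsub>B\<^esub> f z"
proof -
  interpret A: dg_ring A by fact
  interpret B: dg_ring B by fact
  interpret f: ring_hom_ring A B f
    by (intro ring_hom_ringI2 A.ring_axioms B.ring_axioms dg_ring_hom_graded(2)[OF f])
  interpret a: abelian_subgroup "coboundaries A i" A
    by (rule abelian_subgroupI3[OF A.coboundaries_subgroup A.is_abelian_group])
  interpret b: abelian_subgroup "coboundaries B i" B
    by (rule abelian_subgroupI3[OF B.coboundaries_subgroup B.is_abelian_group])
  have zc: "z \<in> carrier A" by (rule A.cocycle_carrier[OF z])
  have "coboundaries B i +>\<^bsub>B\<^esub> f x = coboundaries B i +>\<^bsub>B\<^esub> f z"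
    if "x \<in> coboundaries A i +>\<^bsub>A\<^esub> z" for x
  proof -
    obtain e where e: "e \<in> homog A (i - 1)" and x: "x = differential A e \<oplus>\<^bsub>A\<^esub> z"
      using \<open>x \<in> _\<close> unfolding a_r_coset_def' coboundaries_def by blast
    have ec: "e \<in> carrier A" by (rule A.weak.homog_closed[OF e])
    have "f x = differential B (f e) \<oplus>\<^bsub>B\<^esub> f z"
      unfolding x using zc ec A.differential_closed[OF ec] dg_ring_hom_graded(4)[OF f ec] by simp
    moreover have "differential B (f e) \<in> coboundaries B i"
      unfolding coboundaries_def using dg_ring_hom_graded(3)[OF f e] by blast
    ultimately have "f x \<in> coboundaries B i +>\<^bsub>B\<^esub> f z" unfolding a_r_coset_def' by blast
    then show ?thesis using b.a_repr_independence'[of "f x" "f z"] zc by simp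
  qed
  then show ?thesis
    unfolding cohomology_map_def using a.a_rcos_self[OF zc] by blast
qed

text \<open>Injectivity on \<open>H\<^bsup>k+1\<^esup>\<close> gives \<open>z = d b\<^sub>0\<close>, since \<open>v z\<close> is a coboundary. The error
  \<open>y - v b\<^sub>0\<close> is a cocycle. Surjectivity on \<open>H\<^bsup>k\<^esup>\<close> and surjectivity of \<open>v\<close> itself write it as
  \<open>v a + d (v e')\<close> with \<open>a\<close> a cocycle, and \<open>b\<^sub>0 + a + d e'\<close> is then a solution.\<close>

lemma surjective_quasi_isomorphism_lift:
  assumes "dg_ring R" "dg_ring S" and quasi: "quasi_isomorphism R S v"
    and surj: "v ` carrier R = carrier S"
    and z: "z \<in> homog R (k + 1)" and dz: "differential R z = \<zero>\<^bsub>R\<^esub>"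
    and y: "y \<in> homog S k" and vz: "v z = differential S y"
  obtains b where "b \<in> homog R k" "differential R b = z" "v b = y"
proof -
  interpret R: dg_ring R by fact
  interpret S: dg_ring S by fact
  have v: "v \<in> dg_ring_hom R S" and iso: "\<And>i. cohomology_map S v i \<in> iso (cohomology R i) (cohomology S i)"
    using quasi by (simp_all add: quasi_isomorphism_def)
  have inj: "inj_on (cohomology_map S v i) (carrier (cohomology R i))"
    and onto: "cohomology_map S v i ` carrier (cohomology R i) = carrier (cohomology S i)" for i
    using iso[of i] by (simp_all add: iso_def bij_betw_def)
  interpret v: ring_hom_ring R S v
    by (intro ring_hom_ringI2 R.ring_axioms S.ring_axioms dg_ring_hom_graded(2)[OF v])
  note v_d = dg_ring_hom_graded(4)[OF v] and v_homog = dg_ring_hom_graded(3)[OF v]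
  note lift = graded_surjective[OF R.graded_ring_axioms S.graded_ring_axioms dg_ring_hom_graded(1)[OF v] surj]
  note map_class = cohomology_map_class[OF assms(1,2) v]
  have sub: "abelian_subgroup (coboundaries R i) R" "abelian_subgroup (coboundaries S i) S" for i
    by (intro abelian_subgroupI3 R.coboundaries_subgroup R.is_abelian_group
        S.coboundaries_subgroup S.is_abelian_group)+
  have z_cocycle: "z \<in> cocycles R (k + 1)" using z dz by (simp add: cocycles_def)
  have zero_cocycle: "\<zero>\<^bsub>R\<^esub> \<in> cocycles R (k + 1)"
    using R.weak.homog_zero R.differential_zero by (simp add: cocycles_def)
  have "v z \<in> coboundaries S (k + 1)" unfolding coboundaries_def vz using y by simp
  then have "coboundaries S (k + 1) +>\<^bsub>S\<^esub> v z = coboundaries S (k + 1)"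
    by (rule abelian_subgroup.a_rcos_const[OF sub(2)])
  also have "\<dots> = coboundaries S (k + 1) +>\<^bsub>S\<^esub> v \<zero>\<^bsub>R\<^esub>"
    using additive_subgroup.a_subset[OF S.coboundaries_subgroup] by simp
  finally have "cohomology_map S v (k + 1) (coboundaries R (k + 1) +>\<^bsub>R\<^esub> z) =
      cohomology_map S v (k + 1) (coboundaries R (k + 1) +>\<^bsub>R\<^esub> \<zero>\<^bsub>R\<^esub>)"
    by (simp only: map_class[OF z_cocycle] map_class[OF zero_cocycle])
  then have "coboundaries R (k + 1) +>\<^bsub>R\<^esub> z = coboundaries R (k + 1) +>\<^bsub>R\<^esub> \<zero>\<^bsub>R\<^esub>"
    by (rule inj_onD[OF inj]) (simp_all add: R.cohomology_carrier z_cocycle zero_cocycle)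
  also have "\<dots> = coboundaries R (k + 1)"
    using additive_subgroup.a_subset[OF R.coboundaries_subgroup] by simp
  finally have "z \<in> coboundaries R (k + 1)"
    using abelian_subgroup.a_rcos_self[OF sub(1) R.cocycle_carrier[OF z_cocycle], of "k + 1"] by simp
  then obtain b0 where b0: "b0 \<in> homog R k" "z = differential R b0"
    unfolding coboundaries_def by auto
  have b0c: "b0 \<in> carrier R" by (rule R.weak.homog_closed[OF b0(1)])
  have yc: "y \<in> carrier S" by (rule S.weak.homog_closed[OF y])
  define c where "c = y \<ominus>\<^bsub>S\<^esub> v b0"
  have c: "c \<in> cocycles S k"
    unfolding cocycles_def c_def using S.weak.homog_diff[OF y v_homog[OF b0(1)]]
      S.differential_diff[OF yc v.hom_closed[OF b0c]] v_d[OF b0c] vz b0(2) S.differential_closed[OF yc]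
    by (simp add: S.minus_eq S.r_neg)
  have "coboundaries S k +>\<^bsub>S\<^esub> c \<in> carrier (cohomology S k)"
    unfolding S.cohomology_carrier using c by blast
  then obtain a where a: "a \<in> cocycles R k"
    and class_eq: "coboundaries S k +>\<^bsub>S\<^esub> c = cohomology_map S v k (coboundaries R k +>\<^bsub>R\<^esub> a)"
    unfolding onto[symmetric] R.cohomology_carrier by blast
  have "c \<in> coboundaries S k +>\<^bsub>S\<^esub> v a"
    using abelian_subgroup.a_rcos_self[OF sub(2) S.cocycle_carrier[OF c], of k]
    unfolding class_eq map_class[OF a] .
  then obtain e where e: "e \<in> homog S (k - 1)" and ce: "c = differential S e \<oplus>\<^bsub>S\<^esub> v a"
    unfolding a_r_coset_def' coboundaries_def by blast
  obtain e' where e': "e' \<in> homog R (k - 1)" "v e' = e" using lift[OF e] .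
  have e'c: "e' \<in> carrier R" by (rule R.weak.homog_closed[OF e'(1)])
  have ac: "a \<in> carrier R" "a \<in> homog R k" "differential R a = \<zero>\<^bsub>R\<^esub>"
    using a R.cocycle_carrier[OF a] by (simp_all add: cocycles_def)
  have de': "differential R e' \<in> homog R k" using R.differential_degree[OF e'(1)] by simp
  have de'c: "differential R e' \<in> carrier R" by (rule R.weak.homog_closed[OF de'])
  let ?b = "b0 \<oplus>\<^bsub>R\<^esub> (differential R e' \<oplus>\<^bsub>R\<^esub> a)"
  show thesis
  proof (rule that)
    show "?b \<in> homog R k" by (intro R.weak.homog_add b0(1) de' ac(2))
    show "differential R ?b = z"
      using b0 b0c de'c ac R.weak.homog_closed[OF z]
      by (simp add: R.differential_add R.differential_square[OF e'c])
    have "v ?b = v b0 \<oplus>\<^bsub>S\<^esub> c"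
      unfolding ce using b0c de'c ac e'(2) v_d[OF e'c] by simp
    also have "\<dots> = y"
      unfolding c_def using v.hom_closed[OF b0c] yc
      by (simp add: S.minus_eq S.a_lcomm[of "v b0" y] S.r_neg)
    finally show "v ?b = y" .
  qed
qed

section \<open>Lifting along a surjective quasi-isomorphism\<close>

lemma word_letters_degree:
  assumes "w \<in> lists G" and "\<And>g. g \<in> G \<Longrightarrow> fst g \<le> (0 :: int)"
  shows "word_degree w \<le> 0 \<and> (\<forall>g\<in>set w. word_degree w \<le> fst g)"
  using assms(1)
proof (induction w)
  case (Cons g w)
  then show ?case using assms(2)[of g] by (auto intro: order_trans)
qed simp

lemma (in dg_ring) differential_one: "differential A \<one> = \<zero>"
proof -
  have c: "differential A \<one> \<in> carrier A" by (simp add: differential_closed)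
  have "differential A \<one> = differential A \<one> \<oplus> differential A \<one>"
    using leibniz[OF homog_one homog_one] c by (simp add: koszul_sign_smult)
  then show ?thesis using add.r_cancel_one[OF c c] by simp
qed

lemma nonpositive_graded_set_degree:
  "\<lbrakk>nonpositive_graded_set X; g \<in> Sigma UNIV X\<rbrakk> \<Longrightarrow> fst g \<le> 0"
  unfolding nonpositive_graded_set_def by (cases "fst g > 0") auto

text \<open>The part of the data on which the inductive construction depends: \<open>B2\<close> is spanned over \<open>A\<close> by words in
  generators of nonpositive degree, and graded \<open>A\<close>-ring maps from \<open>B2\<close> to \<open>B1\<close> can be prescribed freely on
  these generators. The two cases of the theorem differ only in how this is established.\<close>

locale lifting_problem =
  A: nonpositive_dg_ring A + B: dg_ring B + B1: dg_ring B1 + B2: dg_ring B2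
  for A :: "('a, 'k) dg_ring_scheme" and B :: "('b, 'l) dg_ring_scheme"
    and B1 :: "('c, 'm) dg_ring_scheme" and B2 :: "('d, 'n) dg_ring_scheme" +
  fixes u1 :: "'a \<Rightarrow> 'c" and u2 :: "'a \<Rightarrow> 'd" and v1 :: "'c \<Rightarrow> 'b" and v2 :: "'d \<Rightarrow> 'b"
    and G :: "(int \<times> 'x) set" and y :: "int \<times> 'x \<Rightarrow> 'd"
  assumes u1: "u1 \<in> dg_ring_hom A B1" and u2: "u2 \<in> dg_ring_hom A B2"
    and v1: "v1 \<in> dg_ring_hom B1 B" and v2: "v2 \<in> dg_ring_hom B2 B"
    and square: "a \<in> carrier A \<Longrightarrow> v1 (u1 a) = v2 (u2 a)"
    and surj: "v1 ` carrier B1 = carrier B" and quasi: "quasi_isomorphism B1 B v1"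
    and nonpos: "g \<in> G \<Longrightarrow> fst g \<le> 0"
    and y: "g \<in> G \<Longrightarrow> y g \<in> homog B2 (fst g)"
    and span: "homog B2 k \<subseteq> generate (add_monoid B2)
      {u2 a \<otimes>\<^bsub>B2\<^esub> word_value B2 y w | i a w. a \<in> homog A i \<and> w \<in> lists G \<and> i + word_degree w = k}"
    and extend: "(\<And>g. g \<in> G \<Longrightarrow> f g \<in> homog B1 (fst g)) \<Longrightarrow>
      \<exists>W\<in>graded_ring_hom B2 B1. (\<forall>i. \<forall>a\<in>homog A i. W (u2 a) = u1 a) \<and> (\<forall>g\<in>G. W (y g) = f g)"
begin

text \<open>Graded \<open>A\<close>-ring maps that need not respect the differentials or the maps to \<open>B\<close>.\<close>

definition extensions :: "('d \<Rightarrow> 'c) set" where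
  "extensions = {W \<in> graded_ring_hom B2 B1. \<forall>i. \<forall>a\<in>homog A i. W (u2 a) = u1 a}"

lemma u2_homog: "a \<in> homog A i \<Longrightarrow> u2 a \<in> homog B2 i"
  by (rule dg_ring_hom_graded(3)[OF u2])

lemma y_closed: "g \<in> G \<Longrightarrow> y g \<in> carrier B2"
  by (rule B2.weak.homog_closed[OF y])

text \<open>The restriction on the letters of \<open>w\<close> is where nonpositivity enters: if \<open>i + word_degree w = k\<close> with
  \<open>i \<le> 0\<close>, and no letter has positive degree, then every single letter has degree at least \<open>k\<close>.\<close>

lemma monomial_induct [consumes 1, case_names monomial diff]:
  assumes "b \<in> homog B2 k"
    and mono: "\<And>i a w. \<lbrakk>a \<in> homog A i; w \<in> lists {g \<in> G. k \<le> fst g}\<rbrakk>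
      \<Longrightarrow> Q (u2 a \<otimes>\<^bsub>B2\<^esub> word_value B2 y w)"
    and diff: "\<And>b c. \<lbrakk>b \<in> carrier B2; c \<in> carrier B2; Q b; Q c\<rbrakk> \<Longrightarrow> Q (b \<ominus>\<^bsub>B2\<^esub> c)"
  shows "Q b"
proof -
  let ?M = "{u2 a \<otimes>\<^bsub>B2\<^esub> word_value B2 y w | i a w. a \<in> homog A i \<and> w \<in> lists G \<and> i + word_degree w = k}"
  have M: "?M \<subseteq> carrier B2"
    by (auto intro!: B2.m_closed B2.weak.homog_closed[OF u2_homog] B2.word_value_closed[where G = G] y_closed)
  have u2_zero: "u2 \<zero>\<^bsub>A\<^esub> = \<zero>\<^bsub>B2\<^esub>"
    by (rule ring_hom_zero[OF dg_ring_hom_graded(2)[OF u2] A.ring_axioms B2.ring_axioms])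
  have zero: "Q \<zero>\<^bsub>B2\<^esub>"
    using mono[OF A.weak.homog_zero, of "[]"] by (simp add: u2_zero)
  have "b \<in> generate (add_monoid B2) ?M" using span assms(1) by blast
  then show ?thesis
    using M
  proof (induction rule: B2.additive_span_induct)
    case (generator s)
    then obtain i a w where s: "s = u2 a \<otimes>\<^bsub>B2\<^esub> word_value B2 y w"
      and a: "a \<in> homog A i" and w: "w \<in> lists G" and k: "i + word_degree w = k"
      by blast
    \<comment> \<open>A coefficient of positive degree vanishes, so its monomial is zero.\<close>
    show ?case
    proof (cases "i > 0")
      case True
      then have "a = \<zero>\<^bsub>A\<^esub>" using A.nonpositive a by blast
      then show ?thesis using zero u2_zero s B2.word_value_closed[OF w y_closed] by simp
    next
      case False
      then have "w \<in> lists {g \<in> G. k \<le> fst g}"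
        using word_letters_degree[OF w nonpos] k w by (auto simp: in_lists_conv_set)
      then show ?thesis unfolding s by (rule mono[OF a])
    qed
  qed (use zero diff in auto)
qed

text \<open>Agreement in degree \<open>k\<close> is decided by the generators of degree at least \<open>k\<close>. The lemmas that follow
  have the same shape for the other properties of interest.\<close>

lemma homs_agree:
  assumes "ring C" and h: "h \<in> ring_hom B2 C" and h': "h' \<in> ring_hom B2 C"
    and A_eq: "\<And>i a. a \<in> homog A i \<Longrightarrow> h (u2 a) = h' (u2 a)"
    and G_eq: "\<And>g. \<lbrakk>g \<in> G; k \<le> fst g\<rbrakk> \<Longrightarrow> h (y g) = h' (y g)"
    and b: "b \<in> homog B2 k"
  shows "h b = h' b"
proof -
  interpret h: ring_hom_ring B2 C h by (intro ring_hom_ringI2 B2.ring_axioms assms(1) h)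
  interpret h': ring_hom_ring B2 C h' by (intro ring_hom_ringI2 B2.ring_axioms assms(1) h')
  from b show ?thesis
  proof (induction rule: monomial_induct)
    case (monomial i a w)
    let ?L = "{g \<in> G. k \<le> fst g}"
    have "h (word_value B2 y w) = word_value C (\<lambda>g. h (y g)) w"
      by (rule h.hom_word_value[OF monomial(2)]) (simp_all add: y_closed)
    also have "\<dots> = h' (word_value B2 y w)"
      by (rule h'.hom_word_value[OF monomial(2), symmetric]) (simp_all add: y_closed G_eq)
    finally have "h (word_value B2 y w) = h' (word_value B2 y w)" .
    moreover have "u2 a \<in> carrier B2" by (rule B2.weak.homog_closed[OF u2_homog[OF monomial(1)]])
    moreover have "word_value B2 y w \<in> carrier B2"
      by (rule B2.word_value_closed[OF monomial(2)]) (simp add: y_closed)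
    ultimately show ?case using A_eq[OF monomial(1)] by simp
  qed (simp add: h.hom_diff h'.hom_diff)
qed

lemma extensionsD:
  assumes "W \<in> extensions"
  shows "W \<in> ring_hom B2 B1" "b \<in> homog B2 k \<Longrightarrow> W b \<in> homog B1 k"
    "a \<in> homog A i \<Longrightarrow> W (u2 a) = u1 a"
proof -
  have W: "W \<in> graded_ring_hom B2 B1" and A: "\<forall>i. \<forall>a\<in>homog A i. W (u2 a) = u1 a"
    using assms by (simp_all add: extensions_def)
  show "W \<in> ring_hom B2 B1" by (rule graded_ring_homD(1)[OF W])
  show "b \<in> homog B2 k \<Longrightarrow> W b \<in> homog B1 k" by (rule graded_ring_homD(2)[OF W])
  show "a \<in> homog A i \<Longrightarrow> W (u2 a) = u1 a" using A by blast
qed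

lemma extensions_agree:
  assumes "W \<in> extensions" "W' \<in> extensions"
    and "\<And>g. \<lbrakk>g \<in> G; k \<le> fst g\<rbrakk> \<Longrightarrow> W (y g) = W' (y g)" and "b \<in> homog B2 k"
  shows "W b = W' b"
  by (rule homs_agree[OF B1.ring_axioms extensionsD(1)[OF assms(1)] extensionsD(1)[OF assms(2)] _ assms(3,4)])
    (simp_all add: extensionsD(3)[OF assms(1)] extensionsD(3)[OF assms(2)])

lemma extension_over_B:
  assumes W: "W \<in> extensions"
    and "\<And>g. \<lbrakk>g \<in> G; k \<le> fst g\<rbrakk> \<Longrightarrow> v1 (W (y g)) = v2 (y g)" and b: "b \<in> homog B2 k"
  shows "v1 (W b) = v2 b"
proof -
  have "(v1 \<circ> W) b = v2 b"
  proof (rule homs_agree[OF B.ring_axioms _ dg_ring_hom_graded(2)[OF v2] _ _ b])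
    show "v1 \<circ> W \<in> ring_hom B2 B"
      by (rule ring_hom_trans[OF extensionsD(1)[OF W] dg_ring_hom_graded(2)[OF v1]])
    show "(v1 \<circ> W) (u2 a) = v2 (u2 a)" if "a \<in> homog A i" for a i
      using extensionsD(3)[OF W that] square[OF A.weak.homog_closed[OF that]] by simp
    show "(v1 \<circ> W) (y g) = v2 (y g)" if "g \<in> G" "k \<le> fst g" for g
      using assms(2)[OF that] by simp
  qed
  then show ?thesis by simp
qed

text \<open>By the Leibniz rule the homogeneous elements on which \<open>W\<close> commutes with the differentials are closed
  under products, and the image of \<open>A\<close> consists of such elements.\<close>

lemma extension_differential:
  assumes W: "W \<in> extensions"
    and G_d: "\<And>g. \<lbrakk>g \<in> G; k \<le> fst g\<rbrakk> \<Longrightarrow> W (differential B2 (y g)) = differential B1 (W (y g))"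
    and b: "b \<in> homog B2 k"
  shows "W (differential B2 b) = differential B1 (W b)"
proof -
  interpret W: ring_hom_ring B2 B1 W
    by (intro ring_hom_ringI2 B2.ring_axioms B1.ring_axioms extensionsD(1)[OF W])
  note W_homog = extensionsD(2)[OF W]
  have mult: "W (differential B2 (b \<otimes>\<^bsub>B2\<^esub> c)) = differential B1 (W (b \<otimes>\<^bsub>B2\<^esub> c))"
    if b: "b \<in> homog B2 i" and c: "c \<in> homog B2 j"
      and d: "W (differential B2 b) = differential B1 (W b)" "W (differential B2 c) = differential B1 (W c)"
    for b c i j
  proof -
    have bc: "b \<in> carrier B2" "c \<in> carrier B2" "differential B2 b \<in> carrier B2" "differential B2 c \<in> carrier B2"
      using b c B2.weak.homog_closed B2.differential_closed by simp_all
    then show ?thesis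
      by (simp add: B2.leibniz[OF b c] B1.leibniz[OF W_homog[OF b] W_homog[OF c]] d W.hom_koszul)
  qed
  have word: "W (differential B2 (word_value B2 y w)) = differential B1 (W (word_value B2 y w))"
    if "w \<in> lists {g \<in> G. k \<le> fst g}" for w
    using that
  proof (induction w)
    case Nil
    show ?case by (simp add: B1.differential_one B2.differential_one)
  next
    case (Cons g w)
    then show ?case
      using mult[OF y B2.weak.word_value_homog[where G = G]] G_d y by (auto simp: in_lists_conv_set)
  qed
  from b show ?thesis
  proof (induction rule: monomial_induct)
    case (monomial i a w)
    have "W (differential B2 (u2 a)) = W (u2 (differential A a))"
      using dg_ring_hom_graded(4)[OF u2 A.weak.homog_closed[OF monomial(1)]] by simp
    also have "\<dots> = differential B1 (W (u2 a))"
      using extensionsD(3)[OF W] A.differential_degree[OF monomial(1)] monomial(1)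
        dg_ring_hom_graded(4)[OF u1 A.weak.homog_closed[OF monomial(1)]] by simp
    finally have "W (differential B2 (u2 a)) = differential B1 (W (u2 a))" .
    then show ?case
      using mult[OF u2_homog[OF monomial(1)] B2.weak.word_value_homog[OF monomial(2)]] word[OF monomial(2)] y
      by simp
  next
    case (diff b c)
    then show ?case
      by (simp add: B2.differential_diff B1.differential_diff W.hom_diff B2.differential_closed)
  qed
qed

text \<open>Stage \<open>n\<close> of the construction: correctness on the generators of degree greater than \<open>-n\<close>.\<close>

definition good :: "nat \<Rightarrow> ('d \<Rightarrow> 'c) \<Rightarrow> bool" where
  "good n W \<longleftrightarrow> W \<in> extensions \<and>
    (\<forall>g\<in>G. - int n < fst g \<longrightarrow>
      W (differential B2 (y g)) = differential B1 (W (y g)) \<and> v1 (W (y g)) = v2 (y g))"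

text \<open>For a generator \<open>y g\<close> of degree \<open>-n\<close>, the differential \<open>d (y g)\<close> only involves generators of larger degree,
  where \<open>W\<close> is already correct. So \<open>W (d (y g))\<close> is a cocycle over \<open>d (v2 (y g))\<close>, and
  \<open>surjective_quasi_isomorphism_lift\<close> supplies the new value of \<open>y g\<close>.\<close>

lemma good_step:
  assumes "good n W"
  shows "\<exists>W'. good (Suc n) W' \<and> (\<forall>g\<in>G. - int n < fst g \<longrightarrow> W' (y g) = W (y g))"
proof -
  have W: "W \<in> extensions"
    and W_d: "\<And>g. \<lbrakk>g \<in> G; - int n < fst g\<rbrakk> \<Longrightarrow> W (differential B2 (y g)) = differential B1 (W (y g))"
    and W_v: "\<And>g. \<lbrakk>g \<in> G; - int n < fst g\<rbrakk> \<Longrightarrow> v1 (W (y g)) = v2 (y g)"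
    using assms unfolding good_def by auto
  note W_homog = extensionsD(2)[OF W]
  let ?k = "- int n"
  have "\<exists>b. b \<in> homog B1 ?k \<and> differential B1 b = W (differential B2 (y g)) \<and> v1 b = v2 (y g)"
    if g: "g \<in> G" "fst g = ?k" for g
  proof -
    have yg: "y g \<in> homog B2 ?k" using y[OF g(1)] g(2) by simp
    have dyg: "differential B2 (y g) \<in> homog B2 (?k + 1)" by (rule B2.differential_degree[OF yg])
    have "differential B1 (W (differential B2 (y g))) = W (differential B2 (differential B2 (y g)))"
      by (rule extension_differential[OF W _ dyg, symmetric]) (simp add: W_d)
    also have "\<dots> = \<zero>\<^bsub>B1\<^esub>"
      using B2.differential_square[OF y_closed[OF g(1)]]
        ring_hom_zero[OF extensionsD(1)[OF W] B2.ring_axioms B1.ring_axioms] by simp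
    finally have dz: "differential B1 (W (differential B2 (y g))) = \<zero>\<^bsub>B1\<^esub>" .
    have "v1 (W (differential B2 (y g))) = v2 (differential B2 (y g))"
      by (rule extension_over_B[OF W _ dyg]) (simp add: W_v)
    also have "\<dots> = differential B (v2 (y g))" by (rule dg_ring_hom_graded(4)[OF v2 y_closed[OF g(1)]])
    finally have vz: "v1 (W (differential B2 (y g))) = differential B (v2 (y g))" .
    show ?thesis
      using surjective_quasi_isomorphism_lift[OF B1.dg_ring_axioms B.dg_ring_axioms quasi surj
          W_homog[OF dyg] dz dg_ring_hom_graded(3)[OF v2 yg] vz] by metis
  qed
  then obtain p where p: "\<And>g. \<lbrakk>g \<in> G; fst g = ?k\<rbrakk> \<Longrightarrow>
      p g \<in> homog B1 ?k \<and> differential B1 (p g) = W (differential B2 (y g)) \<and> v1 (p g) = v2 (y g)"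
    by metis
  define f where "f g = (if fst g = ?k then p g else W (y g))" for g
  have "f g \<in> homog B1 (fst g)" if "g \<in> G" for g
    using p[OF that] W_homog[OF y[OF that]] by (simp add: f_def)
  then obtain W' where W': "W' \<in> extensions" and W'_y: "\<And>g. g \<in> G \<Longrightarrow> W' (y g) = f g"
    using extend[of f] unfolding extensions_def by blast
  have keep: "W' (y g) = W (y g)" if "g \<in> G" "?k < fst g" for g
    using W'_y[OF that(1)] that(2) by (simp add: f_def)
  have agree: "W' (differential B2 (y g)) = W (differential B2 (y g))" if "g \<in> G" "?k \<le> fst g" for g
    by (rule extensions_agree[OF W' W _ B2.differential_degree[OF y[OF that(1)]]])
      (use keep that(2) in simp)
  have "good (Suc n) W'"
    unfolding good_def
  proof (intro conjI ballI impI W')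
    fix g assume g: "g \<in> G" "- int (Suc n) < fst g"
    then have le: "?k \<le> fst g" by simp
    show "W' (differential B2 (y g)) = differential B1 (W' (y g))" "v1 (W' (y g)) = v2 (y g)"
      using agree[OF g(1) le] keep[OF g(1)] p[OF g(1)] W_d[OF g(1)] W_v[OF g(1)] W'_y[OF g(1)] le
      by (cases "fst g = ?k"; simp add: f_def)+
  qed
  with keep show ?thesis by blast
qed

text \<open>Later stages do not change the values on the generators where an earlier stage is correct, so the
  values stabilize for each generator separately and define a graded \<open>A\<close>-ring map that agrees with
  every stage as far as that stage is correct.\<close>

theorem lift_exists:
  "\<exists>w \<in> dg_ring_hom B2 B1.
    (\<forall>a\<in>carrier A. w (u2 a) = u1 a) \<and> (\<forall>b\<in>carrier B2. v1 (w b) = v2 b)"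
proof -
  obtain W0 where "W0 \<in> extensions"
    using extend[of "\<lambda>_. \<zero>\<^bsub>B1\<^esub>"] B1.weak.homog_zero unfolding extensions_def by blast
  then have "good 0 W0" using nonpos unfolding good_def by fastforce
  then obtain Ws where Ws: "\<And>n. good n (Ws n)"
    and step: "\<And>n g. \<lbrakk>g \<in> G; - int n < fst g\<rbrakk> \<Longrightarrow> Ws (Suc n) (y g) = Ws n (y g)"
    using dependent_nat_choice[of good "\<lambda>n W W'. \<forall>g\<in>G. - int n < fst g \<longrightarrow> W' (y g) = W (y g)"]
      good_step by blast
  have stable: "Ws m (y g) = Ws n (y g)" if "g \<in> G" "- int n < fst g" "n \<le> m" for m n g
    using that(3)
  proof (induction m rule: dec_induct)
    case (step m)
    then show ?case using \<open>\<And>n g. \<lbrakk>g \<in> G; - int n < fst g\<rbrakk> \<Longrightarrow> Ws (Suc n) (y g) = Ws n (y g)\<close>[of g m] that by simp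
  qed simp
  have Ws_ext: "Ws n \<in> extensions" for n using Ws unfolding good_def by blast
  \<comment> \<open>The first stage that is correct on a generator \<open>g\<close>.\<close>
  define N where "N g = Suc (nat (- fst g))" for g :: "int \<times> 'x"
  have N: "- int (N g) < fst g" for g by (simp add: N_def)
  define f where "f g = Ws (N g) (y g)" for g
  have "f g \<in> homog B1 (fst g)" if "g \<in> G" for g
    unfolding f_def by (rule extensionsD(2)[OF Ws_ext y[OF that]])
  then obtain W where W: "W \<in> extensions" and W_y: "\<And>g. g \<in> G \<Longrightarrow> W (y g) = f g"
    using extend[of f] unfolding extensions_def by blast
  have W_eq: "W (y g) = Ws n (y g)" if "g \<in> G" "- int n < fst g" for g n
  proof -
    have "N g \<le> n" using that nonpos[OF that(1)] by (simp add: N_def)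
    show ?thesis
      unfolding W_y[OF that(1)] f_def by (rule stable[OF that(1) N \<open>N g \<le> n\<close>, symmetric])
  qed
  have gen_d: "W (differential B2 (y g)) = differential B1 (W (y g))" and gen_v: "v1 (W (y g)) = v2 (y g)"
    if g: "g \<in> G" for g
  proof -
    have "W (differential B2 (y g)) = Ws (N g) (differential B2 (y g))"
      by (rule extensions_agree[OF W Ws_ext _ B2.differential_degree[OF y[OF g]]])
        (rule W_eq, use N[of g] in simp_all)
    then show "W (differential B2 (y g)) = differential B1 (W (y g))" "v1 (W (y g)) = v2 (y g)"
      using Ws[of "N g"] W_eq[OF g N] g N[of g] unfolding good_def by auto
  qed
  interpret W: ring_hom_ring B2 B1 W
    by (intro ring_hom_ringI2 B2.ring_axioms B1.ring_axioms extensionsD(1)[OF W])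
  interpret v1: ring_hom_ring B1 B v1
    by (intro ring_hom_ringI2 B1.ring_axioms B.ring_axioms dg_ring_hom_graded(2)[OF v1])
  interpret v2: ring_hom_ring B2 B v2
    by (intro ring_hom_ringI2 B2.ring_axioms B.ring_axioms dg_ring_hom_graded(2)[OF v2])
  interpret u1: ring_hom_ring A B1 u1
    by (intro ring_hom_ringI2 A.ring_axioms B1.ring_axioms dg_ring_hom_graded(2)[OF u1])
  interpret u2: ring_hom_ring A B2 u2
    by (intro ring_hom_ringI2 A.ring_axioms B2.ring_axioms dg_ring_hom_graded(2)[OF u2])
  have d: "W (differential B2 b) = differential B1 (W b)" if "b \<in> carrier B2" for b
    using that
  proof (induction rule: B2.graded_induct)
    case (homog i b)
    show ?case by (rule extension_differential[OF W gen_d homog])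
  qed (simp add: B2.differential_add B1.differential_add B2.differential_closed)
  have v: "v1 (W b) = v2 b" if "b \<in> carrier B2" for b
    using that
  proof (induction rule: B2.graded_induct)
    case (homog i b)
    show ?case by (rule extension_over_B[OF W gen_v homog])
  qed simp
  have u: "W (u2 a) = u1 a" if "a \<in> carrier A" for a
    using that
  proof (induction rule: A.graded_induct)
    case (homog i a)
    then show ?case by (rule extensionsD(3)[OF W])
  qed simp
  have "W \<in> dg_ring_hom B2 B1"
    unfolding dg_ring_hom_def using extensionsD(1,2)[OF W] d by auto
  with u v show ?thesis by blast
qed

end

lemma lift_from_polynomial_presentation:
  fixes A :: "('a, 'k) dg_ring_scheme" and B :: "('b, 'l) dg_ring_scheme"
    and B1 :: "('c, 'm) dg_ring_scheme" and B2 :: "('d, 'n) dg_ring_scheme"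
    and P :: "('p, 'o) graded_ring_scheme" and G :: "(int \<times> 'x) set"
  assumes "dg_ring B"
    and B1: "nonpositive_central_dg_ring A B1 u1" and B2: "nonpositive_central_dg_ring A B2 u2"
    and v1: "v1 \<in> central_dg_ring_hom A B1 u1 B u" and v2: "v2 \<in> central_dg_ring_hom A B2 u2 B u"
    and surj: "v1 ` carrier B1 = carrier B" and quasi: "quasi_isomorphism B1 B v1"
    and P: "weakly_graded_ring P" and gen: "word_generated P G y" and free: "free_for P G y B1"
    and nonpos: "\<And>g. g \<in> G \<Longrightarrow> fst g \<le> 0"
    and iso: "graded_tensor_iso A B2 u2 P \<noteq> {}"
  shows "\<exists>w \<in> dg_ring_hom B2 B1.
    (\<forall>a\<in>carrier A. w (u2 a) = u1 a) \<and> (\<forall>b\<in>carrier B2. v1 (w b) = v2 b)"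
proof -
  have cA: "commutative_dg_ring A" and dg: "dg_ring B1" "dg_ring B2"
    and u1: "u1 \<in> dg_ring_hom A B1" and u2: "u2 \<in> dg_ring_hom A B2"
    and center: "u1 ` carrier A \<subseteq> graded_center B1"
    using B1 B2 by (simp_all add: nonpositive_central_dg_ring_def central_pair_def)
  interpret A: commutative_dg_ring A by (rule cA)
  interpret B: dg_ring B by fact
  interpret B1: dg_ring B1 by (rule dg)
  interpret B2: dg_ring B2 by (rule dg)
  obtain \<phi> where \<phi>: "\<phi> \<in> graded_tensor_iso A B2 u2 P" using iso by blast
  obtain \<pi> where "tensor_presentation A P B2 u2 \<pi>"
    by (rule tensor_presentation_of_iso[OF A.weakly_graded P B2.weakly_graded \<phi>
          B2.weak.homog_closed[OF dg_ring_hom_graded(3)[OF u2]]])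
  then interpret T: tensor_presentation A P B2 u2 \<pi> .
  have y: "\<And>g. g \<in> G \<Longrightarrow> y g \<in> homog P (fst g)" using gen by (simp add: word_generated_def)
  have central: "u1 a \<otimes>\<^bsub>B1\<^esub> c = [koszul_sign (i * j)] \<cdot>\<^bsub>B1\<^esub> (c \<otimes>\<^bsub>B1\<^esub> u1 a)"
    if "a \<in> homog A i" "c \<in> homog B1 j" for a c i j
    by (rule B1.graded_center_commute[OF _ dg_ring_hom_graded(3)[OF u1 that(1)] that(2)])
      (use center A.weak.homog_closed[OF that(1)] in blast)
  interpret lifting_problem A B B1 B2 u1 u2 v1 v2 G "T.lift y"
  proof (intro lifting_problem.intro lifting_problem_axioms.intro A.nonpositive_dg_ring_axioms
      B.dg_ring_axioms dg u1 u2 surj quasi nonpos T.monomials_span gen T.lift_homog y)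
    show "v1 \<in> dg_ring_hom B1 B" "v2 \<in> dg_ring_hom B2 B"
      using v1 v2 by (simp_all add: central_dg_ring_hom_def)
    show "v1 (u1 a) = v2 (u2 a)" if "a \<in> carrier A" for a
      using v1 v2 that by (simp add: central_dg_ring_hom_def)
    fix f assume f: "\<And>g. g \<in> G \<Longrightarrow> f g \<in> homog B1 (fst g)"
    show "\<exists>W\<in>graded_ring_hom B2 B1.
        (\<forall>i. \<forall>a\<in>homog A i. W (u2 a) = u1 a) \<and> (\<forall>g\<in>G. W (T.lift y g) = f g)"
      by (rule T.graded_hom_extension[OF B1.weakly_graded free y dg_ring_hom_graded(1)[OF u1] central f])
  qed
  show ?thesis by (rule lift_exists)
qed

theorem theorem3p22:
  fixes A :: "'a dg_ring" and B :: "'b dg_ring" and B1 :: "'c dg_ring" and B2 :: "'d dg_ring"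
    and u :: "'a \<Rightarrow> 'b" and u1 :: "'a \<Rightarrow> 'c" and u2 :: "'a \<Rightarrow> 'd"
    and v1 :: "'c \<Rightarrow> 'b" and v2 :: "'d \<Rightarrow> 'b"
  assumes "central_pair A B u" and "nonpositive_dg_ring B"
    and "nonpositive_central_dg_ring A B1 u1"
    and "nonpositive_central_dg_ring A B2 u2"
    and "v1 \<in> central_dg_ring_hom A B1 u1 B u"
    and "v2 \<in> central_dg_ring_hom A B2 u2 B u"
    and "v1 ` carrier B1 = carrier B" and "quasi_isomorphism B1 B v1"
    and "commutative_dg_ring B1 \<and> commutative_semi_free TYPE('x) A B2 u2 \<or>
      noncommutative_semi_free TYPE('y) A B2 u2"
  shows "\<exists>w \<in> dg_ring_hom B2 B1.
    (\<forall>a\<in>carrier A. w (u2 a) = u1 a) \<and> (\<forall>b\<in>carrier B2. v1 (w b) = v2 b)"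
proof -
  have dg: "dg_ring B" "dg_ring B1"
    using assms(1,3) by (simp_all add: central_pair_def nonpositive_central_dg_ring_def)
  then have weak: "weakly_graded_ring B1"
    using dg_ring.axioms(1) graded_ring.weakly_graded by blast
  note lift = lift_from_polynomial_presentation[OF dg(1) assms(3-8)]
  from assms(9) show ?thesis
  proof
    assume "commutative_dg_ring B1 \<and> commutative_semi_free TYPE('x) A B2 u2"
    then obtain X :: "int \<Rightarrow> 'x set" where B1: "commutative_dg_ring B1" and X: "nonpositive_graded_set X"
      and iso: "graded_tensor_iso A B2 u2 (comm_polynomial_ring X) \<noteq> {}"
      by (auto simp: commutative_semi_free_def)
    interpret B1: commutative_dg_ring B1 by (rule B1)
    show ?thesis
      by (rule lift[OF comm_polynomial_projection(2) comm_word_generated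
            comm_free_for[OF weak B1.graded_commutative B1.odd_square_zero] nonpositive_graded_set_degree[OF X] iso])
  next
    assume "noncommutative_semi_free TYPE('y) A B2 u2"
    then obtain X :: "int \<Rightarrow> 'y set" where X: "nonpositive_graded_set X"
      and iso: "graded_tensor_iso A B2 u2 (noncomm_polynomial_ring X) \<noteq> {}"
      by (auto simp: noncommutative_semi_free_def)
    show ?thesis
      by (rule lift[OF weakly_graded_noncomm_polynomial_ring noncomm_word_generated
            noncomm_free_for[OF weak] nonpositive_graded_set_degree[OF X] iso])
  qed
qed

end
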